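(* Let $(J,R,Q,B)\in\Sigma_{n,m}$ and $S\in\mathbb{K}^{m\times m}$ with $S=S^H\ge0$. If $$B\ker S\cap\ker RQ=\{0\}=\ker B\cap\ker S,\qquad(\ast)$$ then the pencil $s\mathcal{E}-\mathcal{A}_S$ is regular. The converse is false in general, i.e. there exist such data for which $s\mathcal{E}-\mathcal{A}_S$ is regular but $(\ast)$ fails. Moreover, if $(\ast)$ holds, then optimal controls for the optimal control problem $$\min_{u\in L^1([t_0,t_1],\mathbb{K}^m)}\ \frac12\int_{t_0}^{t_1}\big[x(t)^HQRQx(t)+u(t)^HSu(t)\big]\,\mathrm{d}t$$ subject to $\tfrac{\mathrm{d}}{\mathrm{d}t}x(t)=(J-R)Qx(t)+Bu(t)$ for a.e. $t\in[t_0,t_1]$, $x(t_0)=x^0$, $x(t_1)=x^1$, are unique (if they exist).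
   Context: $\mathbb{K}\in\{\mathbb{R},\mathbb{C}\}$, $n,m$ are positive integers, $A^H$ is the conjugate transpose, and $A\ge0$ means $x^HAx\ge0$ for all $x$. $t_0<t_1$ are real and $x^0,x^1\in\mathbb{K}^n$ are given; states $x$ are absolutely continuous, $x\in W^{1,1}([t_0,t_1],\mathbb{K}^n)$. $\Sigma_{n,m}$ is the set of all $(J,R,Q,B)\in(\mathbb{K}^{n\times n})^3\times\mathbb{K}^{n\times m}$ with $J=-J^H$, $R=R^H\ge0$, $Q=Q^H\ge0$. The optimality pencil $s\mathcal{E}-\mathcal{A}_S$ has coefficients $$\mathcal{E}=\begin{bmatrix}0_{n\times n}&I_n&0_{n\times m}\\-I_n&0_{n\times n}&0_{n\times m}\\0_{m\times n}&0_{m\times n}&0_{m\times m}\end{bmatrix},\qquad \mathcal{A}_S=\begin{bmatrix}0_{n\times n}&(J-R)Q&B\\((J-R)Q)^H&QRQ&0_{n\times m}\\ B^H&0_{m\times n}&S\end{bmatrix}.$$ It is called regular if $\det(s\mathcal{E}-\mathcal{A}_S)$ is not the zero polynomial in $s$. $B\ker S$ denotes the image of $\ker S$ under $B$. *)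

theory Defs
  imports "HOL-Analysis.Analysis" "Jordan_Normal_Form.Conjugate"
begin

text \<open>
  The scalar field \<open>\<bbbK> \<in> {\<real>, \<complex>}\<close>. The class axiom says that the type is, up to an isometric
  isomorphism respecting conjugation, either the field of real or the field of complex numbers.
\<close>

class real_or_complex = conjugatable_field + real_normed_field + euclidean_space +
  assumes real_or_complex_iso:
    "\<exists>h :: 'a \<Rightarrow> complex.
       (\<forall>x y. h (x + y) = h x + h y) \<and> (\<forall>x y. h (x * y) = h x * h y) \<and>
       (\<forall>r x. h (scaleR r x) = scaleR r (h x)) \<and> (\<forall>x. norm (h x) = norm x) \<and>
       (\<forall>x. h (conjugate x) = cnj (h x)) \<and>
       (range h = \<real> \<or> range h = UNIV)"

instance real :: real_or_complex
proof
  show "\<exists>h :: real \<Rightarrow> complex.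
       (\<forall>x y. h (x + y) = h x + h y) \<and> (\<forall>x y. h (x * y) = h x * h y) \<and>
       (\<forall>r x. h (scaleR r x) = scaleR r (h x)) \<and> (\<forall>x. norm (h x) = norm x) \<and>
       (\<forall>x. h (conjugate x) = cnj (h x)) \<and> (range h = \<real> \<or> range h = UNIV)"
    by (rule exI[of _ complex_of_real]) (auto simp: scaleR_conv_of_real Reals_def)
qed

instance complex :: real_or_complex
proof
  show "\<exists>h :: complex \<Rightarrow> complex.
       (\<forall>x y. h (x + y) = h x + h y) \<and> (\<forall>x y. h (x * y) = h x * h y) \<and>
       (\<forall>r x. h (scaleR r x) = scaleR r (h x)) \<and> (\<forall>x. norm (h x) = norm x) \<and>
       (\<forall>x. h (conjugate x) = cnj (h x)) \<and> (range h = \<real> \<or> range h = UNIV)"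
    by (rule exI[of _ id]) auto
qed

text \<open>
  An \<open>r \<times> c\<close> matrix over \<open>\<bbbK>\<close> has type \<open>'k^'c^'r\<close>.
\<close>

definition ctranspose :: "'k::conjugate^'c^'r \<Rightarrow> 'k^'r^'c"  ("(_\<^sup>H)" [1000] 999)
  where "A\<^sup>H = (\<chi> i j. conjugate (A $ j $ i))"

text \<open>The value \<open>x\<^sup>H A x\<close>.\<close>

definition qform :: "'k::real_or_complex^'n^'n \<Rightarrow> 'k^'n \<Rightarrow> 'k"
  where "qform A x = (\<Sum>i\<in>UNIV. conjugate (x $ i) * (A *v x) $ i)"

definition psd :: "'k::real_or_complex^'n^'n \<Rightarrow> bool"
  where "psd A \<longleftrightarrow> (\<forall>x. qform A x \<in> \<real>\<^sub>\<ge>\<^sub>0)"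

definition mker :: "'k::real_or_complex^'c^'r \<Rightarrow> ('k^'c) set"
  where "mker A = {x. A *v x = 0}"

text \<open>The set \<open>\<Sigma>\<^bsub>n,m\<^esub>\<close>, with the dimensions given by the index types.\<close>

definition Sigma_pH ::
    "(('k::real_or_complex^'n^'n) \<times> ('k^'n^'n) \<times> ('k^'n^'n) \<times> ('k^'m^'n)) set"
  where "Sigma_pH = {(J, R, Q, B). J = - J\<^sup>H \<and> R = R\<^sup>H \<and> psd R \<and> Q = Q\<^sup>H \<and> psd Q}"

definition kernel_condition ::
    "'k::real_or_complex^'n^'n \<Rightarrow> 'k^'n^'n \<Rightarrow> 'k^'m^'n \<Rightarrow> 'k^'m^'m \<Rightarrow> bool"
  where "kernel_condition R Q B S \<longleftrightarrow>
    (\<lambda>u. B *v u) ` mker S \<inter> mker (R ** Q) = {0} \<and> mker B \<inter> mker S = {0}"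

fun block3 :: "'k^'n^'n \<Rightarrow> 'k^'n^'n \<Rightarrow> 'k^'m^'n \<Rightarrow>
               'k^'n^'n \<Rightarrow> 'k^'n^'n \<Rightarrow> 'k^'m^'n \<Rightarrow>
               'k^'n^'m \<Rightarrow> 'k^'n^'m \<Rightarrow> 'k^'m^'m \<Rightarrow>
               ('n + 'n + 'm) \<Rightarrow> ('n + 'n + 'm) \<Rightarrow> 'k"
  where
  "block3 A11 A12 A13 A21 A22 A23 A31 A32 A33 (Inl i)       (Inl j)       = A11 $ i $ j"
| "block3 A11 A12 A13 A21 A22 A23 A31 A32 A33 (Inl i)       (Inr (Inl j)) = A12 $ i $ j"
| "block3 A11 A12 A13 A21 A22 A23 A31 A32 A33 (Inl i)       (Inr (Inr j)) = A13 $ i $ j"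
| "block3 A11 A12 A13 A21 A22 A23 A31 A32 A33 (Inr (Inl i)) (Inl j)       = A21 $ i $ j"
| "block3 A11 A12 A13 A21 A22 A23 A31 A32 A33 (Inr (Inl i)) (Inr (Inl j)) = A22 $ i $ j"
| "block3 A11 A12 A13 A21 A22 A23 A31 A32 A33 (Inr (Inl i)) (Inr (Inr j)) = A23 $ i $ j"
| "block3 A11 A12 A13 A21 A22 A23 A31 A32 A33 (Inr (Inr i)) (Inl j)       = A31 $ i $ j"
| "block3 A11 A12 A13 A21 A22 A23 A31 A32 A33 (Inr (Inr i)) (Inr (Inl j)) = A32 $ i $ j"
| "block3 A11 A12 A13 A21 A22 A23 A31 A32 A33 (Inr (Inr i)) (Inr (Inr j)) = A33 $ i $ j"

definition E_pencil :: "'k::real_or_complex^('n::finite + 'n + 'm::finite)^('n + 'n + 'm)"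
  where "E_pencil = (\<chi> i j. block3
       0           (mat 1)  0
       (- mat 1)   0        0
       0           0        0  i j)"

definition A_pencil ::
    "'k::real_or_complex^'n^'n \<Rightarrow> 'k^'n^'n \<Rightarrow> 'k^'n^'n \<Rightarrow> 'k^'m^'n \<Rightarrow> 'k^'m^'m
       \<Rightarrow> 'k^('n + 'n + 'm)^('n + 'n + 'm)"
  where "A_pencil J R Q B S = (\<chi> i j. block3
       0                     ((J - R) ** Q)   B
       (((J - R) ** Q)\<^sup>H)   (Q ** R ** Q)    0
       (B\<^sup>H)                0                S  i j)"

definition regular_pencil :: "'k::real_or_complex^'l^'l \<Rightarrow> 'k^'l^'l \<Rightarrow> bool"
  where "regular_pencil E A \<longleftrightarrow> det (\<chi> i j. monom (E $ i $ j) 1 - [:A $ i $ j:]) \<noteq> 0"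

text \<open>
  Absolute continuity on \<open>[a, b]\<close>: the elements of a division are finitely many nondegenerate or
  degenerate compact intervals with pairwise disjoint interiors.
\<close>

definition abs_cont_on :: "real \<Rightarrow> real \<Rightarrow> (real \<Rightarrow> 'a::real_normed_vector) \<Rightarrow> bool"
  where "abs_cont_on a b f \<longleftrightarrow>
    (\<forall>\<epsilon>>0. \<exists>\<delta>>0. \<forall>D T. D division_of T \<and> T \<subseteq> {a..b} \<and> (\<Sum>K\<in>D. Sup K - Inf K) < \<delta>
       \<longrightarrow> (\<Sum>K\<in>D. norm (f (Sup K) - f (Inf K))) < \<epsilon>)"

text \<open>
  Controls are represented by integrable functions; \<open>L\<^sup>1\<close> elements are these functions up to
  almost everywhere equality.
\<close>

definition admissible ::
    "'k::real_or_complex^'n^'n \<Rightarrow> 'k^'n^'n \<Rightarrow> 'k^'n^'n \<Rightarrow> 'k^'m^'n \<Rightarrow> real \<Rightarrow> real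
       \<Rightarrow> 'k^'n \<Rightarrow> 'k^'n \<Rightarrow> (real \<Rightarrow> 'k^'n) \<Rightarrow> (real \<Rightarrow> 'k^'m) \<Rightarrow> bool"
  where "admissible J R Q B t0 t1 x0 x1 x u \<longleftrightarrow>
    u absolutely_integrable_on {t0..t1} \<and> abs_cont_on t0 t1 x \<and>
    (AE t in lebesgue. t \<in> {t0..t1} \<longrightarrow>
       (x has_vector_derivative (((J - R) ** Q) *v x t + B *v u t)) (at t within {t0..t1})) \<and>
    x t0 = x0 \<and> x t1 = x1"

text \<open>
  The integrand is a nonnegative real number for the data considered, but it need not be integrable
  for \<open>u \<in> L\<^sup>1\<close>, so the cost takes values in \<open>[0, \<infinity>]\<close>. In \<open>\<real>\<close> and in \<open>\<complex>\<close>, the inner product of \<open>z\<close>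
  with \<open>1\<close> is the real part of \<open>z\<close>.
\<close>

definition cost ::
    "'k::real_or_complex^'n^'n \<Rightarrow> 'k^'n^'n \<Rightarrow> 'k^'m^'m \<Rightarrow> real \<Rightarrow> real
       \<Rightarrow> (real \<Rightarrow> 'k^'n) \<Rightarrow> (real \<Rightarrow> 'k^'m) \<Rightarrow> ennreal"
  where "cost R Q S t0 t1 x u =
    (1/2) * (\<integral>\<^sup>+t\<in>{t0..t1}. ennreal ((qform (Q ** R ** Q) (x t) + qform S (u t)) \<bullet> 1) \<partial>lebesgue)"

definition optimal_control ::
    "'k::real_or_complex^'n^'n \<Rightarrow> 'k^'n^'n \<Rightarrow> 'k^'n^'n \<Rightarrow> 'k^'m^'n \<Rightarrow> 'k^'m^'m \<Rightarrow> real \<Rightarrow> real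
       \<Rightarrow> 'k^'n \<Rightarrow> 'k^'n \<Rightarrow> (real \<Rightarrow> 'k^'m) \<Rightarrow> bool"
  where "optimal_control J R Q B S t0 t1 x0 x1 u \<longleftrightarrow>
    (\<exists>x. admissible J R Q B t0 t1 x0 x1 x u \<and>
       (\<forall>x' u'. admissible J R Q B t0 t1 x0 x1 x' u' \<longrightarrow>
          cost R Q S t0 t1 x u \<le> cost R Q S t0 t1 x' u'))"

end

theory Submission
  imports Defs
begin

text \<open>
  Both parts of the theorem that assume the kernel condition use it in the same form: a control value
  \<open>u\<close> with \<open>S u = 0\<close> and \<open>R Q B u = 0\<close> vanishes (\<open>kernel_condition_inject\<close>). In other words, \<open>u\<close> can
  be recovered linearly from \<open>S u\<close> and \<open>R Q B u\<close>.

  Regularity. It suffices that the pencil is invertible at some large real \<open>s\<close>. Otherwise there are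
  kernel vectors \<open>(l, x, u)\<close> with \<open>norm u = 1\<close> for arbitrarily large \<open>s\<close>. Asymptotically,
  \<open>x \<approx> B u / s\<close> and \<open>l \<approx> - Q R Q B u / s\<^sup>2\<close>, so that on \<open>ker S\<close> the remaining equation is governed by
  the form of \<open>B\<^sup>H Q R Q B\<close>. A limit \<open>u'\<close> of the vectors \<open>u\<close> satisfies \<open>S u' = 0\<close> and
  \<open>R Q B u' = 0\<close>, hence \<open>u' = 0\<close>, although \<open>norm u' = 1\<close> (\<open>optimality_system_trivial_kernel\<close>).

  Failure of the converse. The kernel condition only looks at \<open>R Q B u\<close>, that is at dissipation felt
  immediately by the control. If the coupling \<open>J\<close> transports the control to a dissipated state, then
  the pencil is regular anyway (\<open>regular_without_kernel_condition\<close>).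

  Uniqueness. The cost is a nonnegative quadratic form, so by the parallelogram identity half the
  difference \<open>(z, w)\<close> of two optimal pairs has cost zero, provided that the optimal cost is finite.
  This proviso is needed because integrable controls can have infinite cost; it holds because every
  state transfer that is possible with an integrable control is possible with a continuous one
  (\<open>reachable_by_costate_control\<close>, \<open>admissible_imp_finite_cost\<close>). Cost zero means \<open>R Q z = 0\<close> and
  \<open>S w = 0\<close> almost everywhere. Differentiating the first equation yields
  \<open>R Q ((J - R) Q z + B w) = 0\<close>, so by the kernel condition \<open>w\<close> is a linear function of \<open>z\<close>. Thus \<open>z\<close>
  solves a linear homogeneous differential equation with initial value zero, and \<open>z\<close> and \<open>w\<close> vanish
  (\<open>zero_input_if_zero_outputs\<close>).

  The equations hold only almost everywhere, and all arguments about them are reduced to one fact: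
  an absolutely continuous function whose derivative vanishes almost everywhere is constant
  (\<open>abs_cont_on_zero_derivative_imp_eq\<close>). It is applied to pairings \<open>p \<bullet> z\<close> with solutions \<open>p\<close> of the
  adjoint equation (\<open>costate_pairing_constant\<close>).
\<close>

section \<open>Absolutely continuous functions\<close>

lemma abs_cont_onD_interval:
  assumes "abs_cont_on a b f" "e > 0"
  obtains d where "d > 0"
    "\<And>u v. a \<le> u \<Longrightarrow> u \<le> v \<Longrightarrow> v \<le> b \<Longrightarrow> v - u < d \<Longrightarrow> norm (f v - f u) < e"
proof -
  obtain d where "d > 0" and d: "\<And>D T. D division_of T \<Longrightarrow> T \<subseteq> {a..b} \<Longrightarrow>
      (\<Sum>K\<in>D. Sup K - Inf K) < d \<Longrightarrow> (\<Sum>K\<in>D. norm (f (Sup K) - f (Inf K))) < e"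
    using assms(1)[unfolded abs_cont_on_def, rule_format, OF assms(2)] by blast
  have "norm (f v - f u) < e" if "a \<le> u" "u \<le> v" "v \<le> b" "v - u < d" for u v
  proof -
    have "{cbox u v} division_of cbox u v"
      using that by (intro division_of_self) auto
    from d[OF this] show ?thesis using that by simp
  qed
  then show thesis using \<open>d > 0\<close> that by blast
qed

lemma abs_cont_on_imp_continuous_on:
  assumes "abs_cont_on a b f"
  shows "continuous_on {a..b} f"
  unfolding continuous_on_iff
proof (intro ballI allI impI)
  fix x e :: real assume x: "x \<in> {a..b}" and "e > 0"
  then obtain d where "d > 0" and d: "\<And>u v. a \<le> u \<Longrightarrow> u \<le> v \<Longrightarrow> v \<le> b \<Longrightarrow> v - u < d \<Longrightarrow> norm (f v - f u) < e"
    using abs_cont_onD_interval[OF assms] by metis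
  have "dist (f y) (f x) < e" if "y \<in> {a..b}" "dist y x < d" for y
    using d[of x y] d[of y x] x that
    by (cases "x \<le> y") (auto simp: dist_norm norm_minus_commute)
  with \<open>d > 0\<close> show "\<exists>d>0. \<forall>y\<in>{a..b}. dist y x < d \<longrightarrow> dist (f y) (f x) < e" by blast
qed

lemma abs_cont_on_subset:
  assumes "abs_cont_on a b f" "{c..d} \<subseteq> {a..b}"
  shows "abs_cont_on c d f"
  unfolding abs_cont_on_def
proof (intro allI impI)
  fix e :: real assume "e > 0"
  from assms(1)[unfolded abs_cont_on_def, rule_format, OF this]
  obtain \<delta> where "\<delta> > 0" and \<delta>: "\<forall>D T. D division_of T \<and> T \<subseteq> {a..b} \<and> (\<Sum>K\<in>D. Sup K - Inf K) < \<delta>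
       \<longrightarrow> (\<Sum>K\<in>D. norm (f (Sup K) - f (Inf K))) < e" by blast
  show "\<exists>\<delta>>0. \<forall>D T. D division_of T \<and> T \<subseteq> {c..d} \<and> (\<Sum>K\<in>D. Sup K - Inf K) < \<delta>
       \<longrightarrow> (\<Sum>K\<in>D. norm (f (Sup K) - f (Inf K))) < e"
    by (intro exI[of _ \<delta>] conjI \<open>\<delta> > 0\<close> allI impI \<delta>[rule_format]) (use assms(2) in auto)
qed

text \<open>
  Comparing increments is the common reason why linear combinations and products of absolutely
  continuous functions, and Lipschitz functions (compared with the identity), are absolutely
  continuous.
\<close>

lemma abs_cont_on_dominated:
  assumes f: "abs_cont_on a b f" and g: "abs_cont_on a b g" and "C \<ge> 0"
    and le: "\<And>u v. u \<in> {a..b} \<Longrightarrow> v \<in> {a..b} \<Longrightarrow>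
      norm (h v - h u) \<le> C * (norm (f v - f u) + norm (g v - g u))"
  shows "abs_cont_on a b h"
  unfolding abs_cont_on_def
proof (intro allI impI)
  fix e :: real assume "e > 0"
  define e' where "e' = e / (2 * C + 1)"
  have "e' > 0" using \<open>e > 0\<close> \<open>C \<ge> 0\<close> by (simp add: e'_def)
  obtain d1 where "d1 > 0" and d1: "\<And>D T. D division_of T \<Longrightarrow> T \<subseteq> {a..b} \<Longrightarrow>
      (\<Sum>K\<in>D. Sup K - Inf K) < d1 \<Longrightarrow> (\<Sum>K\<in>D. norm (f (Sup K) - f (Inf K))) < e'"
    using f[unfolded abs_cont_on_def, rule_format, OF \<open>e' > 0\<close>] by blast
  obtain d2 where "d2 > 0" and d2: "\<And>D T. D division_of T \<Longrightarrow> T \<subseteq> {a..b} \<Longrightarrow>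
      (\<Sum>K\<in>D. Sup K - Inf K) < d2 \<Longrightarrow> (\<Sum>K\<in>D. norm (g (Sup K) - g (Inf K))) < e'"
    using g[unfolded abs_cont_on_def, rule_format, OF \<open>e' > 0\<close>] by blast
  show "\<exists>d>0. \<forall>D T. D division_of T \<and> T \<subseteq> {a..b} \<and> (\<Sum>K\<in>D. Sup K - Inf K) < d
      \<longrightarrow> (\<Sum>K\<in>D. norm (h (Sup K) - h (Inf K))) < e"
  proof (intro exI[of _ "min d1 d2"] conjI allI impI)
    show "min d1 d2 > 0" using \<open>d1 > 0\<close> \<open>d2 > 0\<close> by simp
    fix D T assume D: "D division_of T \<and> T \<subseteq> {a..b} \<and> (\<Sum>K\<in>D. Sup K - Inf K) < min d1 d2"
    have "(\<Sum>K\<in>D. norm (h (Sup K) - h (Inf K)))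
        \<le> (\<Sum>K\<in>D. C * (norm (f (Sup K) - f (Inf K)) + norm (g (Sup K) - g (Inf K))))"
    proof (rule sum_mono)
      fix K assume K: "K \<in> D"
      then obtain u v where uv: "K = cbox u v" "K \<noteq> {}" "K \<subseteq> T"
        using D by (metis division_ofD(2,3,4))
      then have "u \<in> K" "v \<in> K" "Inf K = u" "Sup K = v" by auto
      then have "Sup K \<in> {a..b}" "Inf K \<in> {a..b}" using D uv(3) by blast+
      then show "norm (h (Sup K) - h (Inf K))
          \<le> C * (norm (f (Sup K) - f (Inf K)) + norm (g (Sup K) - g (Inf K)))"
        using le by blast
    qed
    also have "\<dots> = C * ((\<Sum>K\<in>D. norm (f (Sup K) - f (Inf K))) + (\<Sum>K\<in>D. norm (g (Sup K) - g (Inf K))))"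
      by (simp add: sum.distrib sum_distrib_left[symmetric])
    also have "\<dots> \<le> C * (e' + e')"
      using d1[of D T] d2[of D T] D \<open>C \<ge> 0\<close> by (intro mult_left_mono add_mono) auto
    also have "\<dots> < e"
    proof -
      have "C * (e' + e') = e * (2 * C / (2 * C + 1))" by (simp add: e'_def)
      also have "\<dots> < e * 1"
        using \<open>e > 0\<close> \<open>C \<ge> 0\<close> by (intro mult_strict_left_mono) simp_all
      finally show ?thesis by simp
    qed
    finally show "(\<Sum>K\<in>D. norm (h (Sup K) - h (Inf K))) < e" .
  qed
qed

lemma abs_cont_on_ident: "abs_cont_on a b (\<lambda>t::real. t)"
  unfolding abs_cont_on_def
proof (intro allI impI)
  fix e :: real assume "e > 0"
  show "\<exists>d>0. \<forall>D T. D division_of T \<and> T \<subseteq> {a..b} \<and> (\<Sum>K\<in>D. Sup K - Inf K) < d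
      \<longrightarrow> (\<Sum>K\<in>D. norm (Sup K - Inf K)) < e"
  proof (intro exI[of _ e] conjI allI impI)
    fix D T assume D: "D division_of T \<and> T \<subseteq> {a..b} \<and> (\<Sum>K\<in>D. Sup K - Inf K) < e"
    have "norm (Sup K - Inf K) = Sup K - Inf K" if "K \<in> D" for K :: "real set"
    proof -
      obtain u v where "K = cbox u v" "K \<noteq> {}"
        using D \<open>K \<in> D\<close> by (metis division_ofD(3,4))
      then show ?thesis by auto
    qed
    then have "(\<Sum>K\<in>D. norm (Sup K - Inf K)) = (\<Sum>K\<in>D. Sup K - Inf K)"
      by (rule sum.cong[OF refl])
    then show "(\<Sum>K\<in>D. norm (Sup K - Inf K)) < e" using D by simp
  qed fact
qed

lemma abs_cont_on_lincomb:
  assumes "abs_cont_on a b f" "abs_cont_on a b g"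
  shows "abs_cont_on a b (\<lambda>t. r *\<^sub>R f t + s *\<^sub>R g t)"
proof (rule abs_cont_on_dominated[OF assms, of "\<bar>r\<bar> + \<bar>s\<bar>"])
  fix u v
  have "r *\<^sub>R f v + s *\<^sub>R g v - (r *\<^sub>R f u + s *\<^sub>R g u) = r *\<^sub>R (f v - f u) + s *\<^sub>R (g v - g u)"
    by (simp add: algebra_simps)
  also have "norm \<dots> \<le> \<bar>r\<bar> * norm (f v - f u) + \<bar>s\<bar> * norm (g v - g u)"
    by (rule order_trans[OF norm_triangle_ineq]) simp
  also have "\<dots> \<le> (\<bar>r\<bar> + \<bar>s\<bar>) * (norm (f v - f u) + norm (g v - g u))"
    by (simp add: algebra_simps)
  finally show "norm (r *\<^sub>R f v + s *\<^sub>R g v - (r *\<^sub>R f u + s *\<^sub>R g u))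
      \<le> (\<bar>r\<bar> + \<bar>s\<bar>) * (norm (f v - f u) + norm (g v - g u))" .
qed auto

lemma abs_cont_on_inner:
  assumes f: "abs_cont_on a b f" and g: "abs_cont_on a b g"
  shows "abs_cont_on a b (\<lambda>t. f t \<bullet> g t)"
proof -
  have "bounded (f ` {a..b})" "bounded (g ` {a..b})"
    by (intro compact_imp_bounded compact_continuous_image compact_Icc
        abs_cont_on_imp_continuous_on f g)+
  then obtain F G where F: "F > 0" "\<And>t. t \<in> {a..b} \<Longrightarrow> norm (f t) \<le> F"
    and G: "G > 0" "\<And>t. t \<in> {a..b} \<Longrightarrow> norm (g t) \<le> G"
    unfolding bounded_pos by auto
  show ?thesis
  proof (rule abs_cont_on_dominated[OF f g, of "F + G"])
    fix u v assume uv: "u \<in> {a..b}" "v \<in> {a..b}"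
    have "f v \<bullet> g v - f u \<bullet> g u = f v \<bullet> (g v - g u) + (f v - f u) \<bullet> g u"
      by (simp add: algebra_simps)
    also have "norm \<dots> \<le> norm (f v) * norm (g v - g u) + norm (f v - f u) * norm (g u)"
      unfolding real_norm_def
      by (rule order_trans[OF abs_triangle_ineq add_mono[OF Cauchy_Schwarz_ineq2 Cauchy_Schwarz_ineq2]])
    also have "\<dots> \<le> F * norm (g v - g u) + norm (f v - f u) * G"
      using F G uv by (intro add_mono mult_right_mono mult_left_mono) auto
    also have "\<dots> \<le> (F + G) * (norm (f v - f u) + norm (g v - g u))"
      using F G by (simp add: algebra_simps)
    finally show "norm (f v \<bullet> g v - f u \<bullet> g u) \<le> (F + G) * (norm (f v - f u) + norm (g v - g u))" .
  qed (use F G in auto)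
qed

lemma abs_cont_on_if_continuous_derivative:
  fixes f :: "real \<Rightarrow> 'a::euclidean_space"
  assumes "\<And>t. (f has_vector_derivative f' t) (at t)" "continuous_on {a..b} f'"
  shows "abs_cont_on a b f"
proof -
  have "bounded (f' ` {a..b})"
    by (intro compact_imp_bounded compact_continuous_image compact_Icc assms)
  then obtain C where C: "C > 0" "\<And>t. t \<in> {a..b} \<Longrightarrow> norm (f' t) \<le> C"
    unfolding bounded_pos by auto
  show ?thesis
  proof (rule abs_cont_on_dominated[OF abs_cont_on_ident abs_cont_on_ident, of C])
    fix u v assume uv: "u \<in> {a..b}" "v \<in> {a..b}"
    have "norm (f v - f u) \<le> C * norm (v - u)"
    proof (rule differentiable_bound[where S = "{a..b}" and f' = "\<lambda>t h. h *\<^sub>R f' t"])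
      show "(f has_derivative (\<lambda>h. h *\<^sub>R f' t)) (at t within {a..b})" for t
        using assms(1)[of t] has_derivative_at_withinI unfolding has_vector_derivative_def by blast
      show "onorm (\<lambda>h. h *\<^sub>R f' t) \<le> C" if "t \<in> {a..b}" for t
        using C(2)[OF that] by (intro onorm_le) (simp add: mult.commute[of C] mult_left_mono)
    qed (use uv in auto)
    also have "\<dots> \<le> C * (norm (v - u) + norm (v - u))" using C by simp
    finally show "norm (f v - f u) \<le> C * (norm (v - u) + norm (v - u))" .
  qed (use C in auto)
qed

text \<open>
  The interval is divided into tagged pieces by means of a gauge. A piece whose tag has derivative
  zero is chosen so short that its increment is small compared to its length. The other tags form a
  null set \<open>N\<close>; their pieces stay in an open set \<open>U\<close> around \<open>N\<close> of small measure, so that their total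
  increment is small by absolute continuity.
\<close>

lemma abs_cont_on_zero_derivative_imp_eq:
  fixes f :: "real \<Rightarrow> 'a::real_normed_vector"
  assumes ac: "abs_cont_on a b f" and ab: "a \<le> b"
    and der: "AE t in lebesgue. t \<in> {a..b} \<longrightarrow> (f has_vector_derivative 0) (at t within {a..b})"
  shows "f b = f a"
proof -
  have bound: "norm (f b - f a) \<le> e * (b - a) + e" if "e > 0" for e :: real
  proof -
    obtain \<delta> where "\<delta> > 0" and \<delta>: "\<And>D T. D division_of T \<Longrightarrow> T \<subseteq> {a..b} \<Longrightarrow>
        (\<Sum>K\<in>D. Sup K - Inf K) < \<delta> \<Longrightarrow> (\<Sum>K\<in>D. norm (f (Sup K) - f (Inf K))) < e"
      using ac[unfolded abs_cont_on_def, rule_format, OF \<open>e > 0\<close>] by blast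
    obtain N where N: "N \<in> null_sets lebesgue"
      and derN: "\<And>t. t \<in> {a..b} \<Longrightarrow> t \<notin> N \<Longrightarrow> (f has_vector_derivative 0) (at t within {a..b})"
    proof -
      obtain N where "N \<in> null_sets lebesgue" and
        "\<And>t. t \<in> space lebesgue - N \<Longrightarrow> t \<in> {a..b} \<longrightarrow> (f has_vector_derivative 0) (at t within {a..b})"
        using AE_E3[OF der] by metis
      then show ?thesis by (intro that[of N]) simp_all
    qed
    obtain U where U: "open U" "N \<subseteq> U" "U - N \<in> lmeasurable" "emeasure lebesgue (U - N) < ennreal \<delta>"
      using sets_lebesgue_outer_open[of N \<delta>] N \<open>\<delta> > 0\<close> by (metis null_setsD2)
    have UN: "U = (U - N) \<union> N" using U by auto
    have emU: "emeasure lebesgue U = emeasure lebesgue (U - N)"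
      by (subst UN, rule emeasure_Un_null_set) (use N U in \<open>auto simp: fmeasurable_def\<close>)
    have Ulm: "U \<in> lmeasurable" and mU: "measure lebesgue U < \<delta>"
    proof -
      have "U \<in> sets lebesgue" using U(1) by auto
      moreover have lt: "emeasure lebesgue U < ennreal \<delta>" using emU U(4) by simp
      moreover have fin: "emeasure lebesgue U < top" using lt ennreal_less_top by (rule less_trans)
      ultimately show "U \<in> lmeasurable" "measure lebesgue U < \<delta>"
        unfolding measure_def using enn2real_less_iff[OF fin] by (auto intro: fmeasurableI)
    qed
    have "\<forall>t. \<exists>d>0. t \<in> {a..b} - N \<longrightarrow>
        (\<forall>y\<in>{a..b}. norm (y - t) < d \<longrightarrow> norm (f y - f t) \<le> e * norm (y - t))"
    proof
      fix t
      show "\<exists>d>0. t \<in> {a..b} - N \<longrightarrow>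
        (\<forall>y\<in>{a..b}. norm (y - t) < d \<longrightarrow> norm (f y - f t) \<le> e * norm (y - t))"
      proof (cases "t \<in> {a..b} - N")
        case True
        then have "(f has_vector_derivative 0) (at t within {a..b})" using derN by blast
        then show ?thesis
          using \<open>e > 0\<close> unfolding has_vector_derivative_def has_derivative_within_alt by auto
      qed (auto intro: exI[of _ 1])
    qed
    then obtain d where d: "\<And>t. 0 < d t"
      "\<And>t y. t \<in> {a..b} - N \<Longrightarrow> y \<in> {a..b} \<Longrightarrow> norm (y - t) < d t \<Longrightarrow> norm (f y - f t) \<le> e * norm (y - t)"
      by metis
    define \<gamma> where "\<gamma> t = (if t \<in> N then U else ball t (d t))" for t
    have "gauge \<gamma>"
      using U d(1) by (auto simp: gauge_def \<gamma>_def)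
    then obtain p where p: "p tagged_division_of {a..b}" and fine: "\<gamma> fine p"
      using fine_division_exists_real by blast
    have finp: "finite p" using p by (rule tagged_division_ofD(1))
    define \<phi> where "\<phi> = (\<lambda>(t::real, K::real set). norm (f (Sup K) - f (Inf K)))"
    define p1 where "p1 = {(t, K) \<in> p. t \<notin> N}"
    define p2 where "p2 = {(t, K) \<in> p. t \<in> N}"
    have pU: "p = p1 \<union> p2" "p1 \<inter> p2 = {}" and fin: "finite p1" "finite p2"
      using finp by (auto simp: p1_def p2_def intro: finite_subset[OF _ finp])
    have "sum \<phi> p1 \<le> (\<Sum>(t, K)\<in>p1. e * (Sup K - Inf K))"
    proof (rule sum_mono, clarify)
      fix t K assume tK: "(t, K) \<in> p1"
      then have tK': "(t, K) \<in> p" "t \<notin> N" by (auto simp: p1_def)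
      then obtain u v where K: "K = cbox u v" "t \<in> K" "K \<subseteq> {a..b}"
        using p by (metis tagged_division_ofD(2,3,4))
      have uv: "u \<le> v" "u \<in> {a..b}" "v \<in> {a..b}" "t \<in> {a..b}" "u \<le> t" "t \<le> v" using K by auto
      have "K \<subseteq> \<gamma> t" using fine tK' by (auto simp: fine_def)
      then have "K \<subseteq> ball t (d t)" using tK' by (simp add: \<gamma>_def)
      moreover have "u \<in> K" "v \<in> K" using K uv by auto
      ultimately have "u \<in> ball t (d t)" "v \<in> ball t (d t)" by blast+
      then have nu: "norm (u - t) < d t" and nv: "norm (v - t) < d t"
        by (auto simp: dist_norm norm_minus_commute)
      have "norm (f v - f u) = norm ((f v - f t) - (f u - f t))" by simp
      also have "\<dots> \<le> norm (f v - f t) + norm (f u - f t)" by (rule norm_triangle_ineq4)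
      also have "\<dots> \<le> e * norm (v - t) + e * norm (u - t)"
        using uv tK' nu nv by (intro add_mono d(2)) auto
      also have "\<dots> = e * (v - u)" using uv by (simp add: algebra_simps)
      finally show "\<phi> (t, K) \<le> e * (Sup K - Inf K)" using K uv by (simp add: \<phi>_def)
    qed
    also have "\<dots> \<le> (\<Sum>(t, K)\<in>p. e * (Sup K - Inf K))"
    proof (rule sum_mono2[OF finp])
      show "p1 \<subseteq> p" by (auto simp: p1_def)
      fix z assume "z \<in> p - p1"
      moreover obtain t K where z: "z = (t, K)" by fastforce
      ultimately obtain u v where "K = cbox u v" "t \<in> K" using p by (metis DiffD1 tagged_division_ofD(2,4))
      then show "0 \<le> (case z of (t, K) \<Rightarrow> e * (Sup K - Inf K))" using \<open>e > 0\<close> z by auto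
    qed
    also have "\<dots> = e * (b - a)"
      using additive_tagged_division_1[OF ab, of p "\<lambda>x. x"] p
      by (simp add: sum_distrib_left[symmetric] split_def)
    finally have 1: "sum \<phi> p1 \<le> e * (b - a)" .
    have p2: "p2 tagged_division_of \<Union>(snd ` p2)"
    proof (rule tagged_partial_division_of_Union_self)
      show "p2 tagged_partial_division_of {a..b}"
        by (rule tagged_partial_division_subset[of p])
          (use p in \<open>auto simp: p2_def tagged_division_of_def\<close>)
    qed
    have D: "snd ` p2 division_of \<Union>(snd ` p2)"
      by (rule division_of_tagged_division[OF p2])
    have sub: "\<Union>(snd ` p2) \<subseteq> {a..b}" "\<Union>(snd ` p2) \<subseteq> U"
      using p fine tagged_division_ofD(3)[OF p] by (fastforce simp: p2_def fine_def \<gamma>_def)+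
    have memD: "\<exists>u v. K = cbox u v \<and> u \<le> v" if "K \<in> snd ` p2" for K
      using division_ofD(3,4)[OF D that] by fastforce
    have "(\<Sum>K\<in>snd ` p2. Sup K - Inf K) = (\<Sum>K\<in>snd ` p2. measure lebesgue K)"
      by (rule sum.cong) (use memD in force)+
    also have "\<dots> = measure lebesgue (\<Union>(snd ` p2))"
      by (rule content_division[OF D])
    also have "\<dots> \<le> measure lebesgue U"
      using sub Ulm lmeasurable_division[OF D] by (intro measure_mono_fmeasurable) auto
    also have "\<dots> < \<delta>" by (rule mU)
    finally have "(\<Sum>K\<in>snd ` p2. norm (f (Sup K) - f (Inf K))) < e"
      by (intro \<delta>[OF D sub(1)])
    moreover have "sum \<phi> p2 = (\<Sum>K\<in>snd ` p2. norm (f (Sup K) - f (Inf K)))"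
    proof -
      (* Sup and Inf are unspecified on the empty set, but the sum over tags needs weight 0 there *)
      define \<psi> where "\<psi> K = (if K = {} then 0 else norm (f (Sup K) - f (Inf K)))" for K :: "real set"
      have ne: "K \<noteq> {}" if "K \<in> snd ` p2" for K using division_ofD(3)[OF D that] .
      have "sum \<phi> p2 = (\<Sum>(t, K)\<in>p2. \<psi> K)"
        by (rule sum.cong) (use ne in \<open>force simp: \<phi>_def \<psi>_def\<close>)+
      also have "\<dots> = sum \<psi> (snd ` p2)"
      proof (rule sum.over_tagged_division_lemma[OF p2])
        fix u v :: real assume "box u v = {}"
        then have "v \<le> u" by (simp add: not_less)
        then show "\<psi> (cbox u v) = 0" by (cases "u = v") (auto simp: \<psi>_def)
      qed
      also have "\<dots> = (\<Sum>K\<in>snd ` p2. norm (f (Sup K) - f (Inf K)))"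
        by (rule sum.cong) (use ne in \<open>auto simp: \<psi>_def\<close>)
      finally show ?thesis .
    qed
    ultimately have 2: "sum \<phi> p2 < e" by simp
    have "f b - f a = (\<Sum>(t, K)\<in>p. f (Sup K) - f (Inf K))"
      using additive_tagged_division_1[OF ab, of p f] p by simp
    also have "norm \<dots> \<le> sum \<phi> p"
      by (rule sum_norm_le) (auto simp: \<phi>_def)
    also have "\<dots> = sum \<phi> p1 + sum \<phi> p2"
      unfolding pU(1) by (rule sum.union_disjoint[OF fin pU(2)])
    finally show ?thesis using 1 2 by linarith
  qed
  have "norm (f b - f a) \<le> 0"
  proof (rule field_le_epsilon)
    fix e :: real assume "e > 0"
    define e' where "e' = e / (b - a + 1)"
    have "e' > 0" using \<open>e > 0\<close> ab by (simp add: e'_def)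
    from bound[OF this] have "norm (f b - f a) \<le> e' * (b - a + 1)" by (simp add: algebra_simps)
    also have "\<dots> = e" using ab by (simp add: e'_def)
    finally show "norm (f b - f a) \<le> 0 + e" by simp
  qed
  then show ?thesis by simp
qed

section \<open>Linear differential equations\<close>

text \<open>
  The solution is \<open>exp ((t - t0) L) c\<close>. Its coordinates are real power series, so that they can be
  differentiated termwise without an operator algebra.
\<close>

lemma linear_flow_exists:
  fixes L :: "'a::euclidean_space \<Rightarrow> 'a"
  assumes L: "linear L"
  obtains y where "y t0 = c" "\<And>t. (y has_vector_derivative L (y t)) (at t)"
proof -
  have bl: "bounded_linear L" using L by (simp add: linear_conv_bounded_linear)
  obtain C where C: "C > 0" "\<And>x. norm (L x) \<le> C * norm x"
    using bounded_linear.pos_bounded[OF bl] by (auto simp: mult.commute)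
  have pow: "norm ((L ^^ k) c) \<le> C ^ k * norm c" for k
  proof (induction k)
    case (Suc k)
    have "norm (L ((L ^^ k) c)) \<le> C * norm ((L ^^ k) c)" by (rule C)
    also have "\<dots> \<le> C * (C ^ k * norm c)" using Suc C by (intro mult_left_mono) auto
    finally show ?case by (simp add: mult.assoc)
  qed simp
  define a where "a b k = ((L ^^ k) c \<bullet> b) / fact k" for b :: 'a and k :: nat
  define f where "f b s = (\<Sum>k. a b k * s ^ k)" for b s
  have summ: "summable (\<lambda>k. a b k * s ^ k)" if "b \<in> Basis" for b s
  proof (rule summable_comparison_test)
    show "summable (\<lambda>k. norm c * (inverse (fact k) * (C * \<bar>s\<bar>) ^ k))"
      by (intro summable_mult summable_exp)
    show "\<exists>N. \<forall>k\<ge>N. norm (a b k * s ^ k) \<le> norm c * (inverse (fact k) * (C * \<bar>s\<bar>) ^ k)"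
    proof (intro exI allI impI)
      fix k
      have "\<bar>(L ^^ k) c \<bullet> b\<bar> \<le> C ^ k * norm c"
        using Basis_le_norm[OF that, of "(L ^^ k) c"] pow[of k] by linarith
      then have "\<bar>(L ^^ k) c \<bullet> b\<bar> * (\<bar>s\<bar> ^ k / fact k) \<le> C ^ k * norm c * (\<bar>s\<bar> ^ k / fact k)"
        by (intro mult_right_mono) auto
      then show "norm (a b k * s ^ k) \<le> norm c * (inverse (fact k) * (C * \<bar>s\<bar>) ^ k)"
        by (simp add: a_def abs_mult power_abs power_mult_distrib field_simps)
    qed
  qed
  have Lb: "L x \<bullet> b = (\<Sum>b'\<in>Basis. (x \<bullet> b') * (L b' \<bullet> b))" for x b
  proof -
    have "L x = L (\<Sum>b'\<in>Basis. (x \<bullet> b') *\<^sub>R b')" by (simp add: euclidean_representation)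
    also have "\<dots> = (\<Sum>b'\<in>Basis. (x \<bullet> b') *\<^sub>R L b')" by (simp add: linear_sum[OF L] linear_cmul[OF L])
    finally show ?thesis by (simp add: inner_sum_left)
  qed
  have der: "(f b has_field_derivative (\<Sum>b'\<in>Basis. f b' s * (L b' \<bullet> b))) (at s)" if b: "b \<in> Basis" for b s
  proof -
    have "(f b has_field_derivative (\<Sum>k. diffs (a b) k * s ^ k)) (at s)"
      unfolding f_def[abs_def] by (rule termdiffs_strong_converges_everywhere) (rule summ[OF b])
    moreover have "(\<Sum>k. diffs (a b) k * s ^ k) = (\<Sum>k. \<Sum>b'\<in>Basis. (a b' k * s ^ k) * (L b' \<bullet> b))"
    proof (rule arg_cong[of _ _ suminf], rule ext)
      fix k
      have "diffs (a b) k = (L ((L ^^ k) c) \<bullet> b) / fact k"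
        by (simp add: diffs_def a_def del: of_nat_Suc)
      also have "\<dots> = (\<Sum>b'\<in>Basis. a b' k * (L b' \<bullet> b))"
        by (subst Lb) (simp add: a_def sum_divide_distrib)
      finally have diffs: "diffs (a b) k = (\<Sum>b'\<in>Basis. a b' k * (L b' \<bullet> b))" .
      show "diffs (a b) k * s ^ k = (\<Sum>b'\<in>Basis. (a b' k * s ^ k) * (L b' \<bullet> b))"
        unfolding diffs sum_distrib_right by (intro sum.cong) (simp_all add: mult_ac)
    qed
    moreover have "\<dots> = (\<Sum>b'\<in>Basis. f b' s * (L b' \<bullet> b))"
      unfolding f_def by (subst suminf_sum) (auto intro!: summable_mult2 summ sum.cong suminf_mult2[symmetric])
    ultimately show ?thesis by simp
  qed
  define y where "y t = (\<Sum>b\<in>Basis. f b (t - t0) *\<^sub>R b)" for t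
  have yb: "y t \<bullet> b = f b (t - t0)" if "b \<in> Basis" for t b
    using that by (simp add: y_def inner_sum_left inner_Basis if_distrib sum.delta cong: if_cong)
  show thesis
  proof
    have "f b 0 = c \<bullet> b" for b
    proof -
      have "(\<lambda>k. a b k * 0 ^ k) sums (a b 0)" using powser_sums_zero[of "a b"] .
      then show ?thesis by (simp add: f_def a_def sums_iff)
    qed
    then show "y t0 = c" by (simp add: y_def euclidean_representation)
    fix t
    have "((\<lambda>t. f b (t - t0)) has_vector_derivative (\<Sum>b'\<in>Basis. f b' (t - t0) * (L b' \<bullet> b))) (at t)"
      if "b \<in> Basis" for b
      using DERIV_shift[of "f b" _ t "- t0"] der[OF that, of "t - t0"]
      by (simp add: has_real_derivative_iff_has_vector_derivative)
    then have "(y has_vector_derivative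
        (\<Sum>b\<in>Basis. (\<Sum>b'\<in>Basis. f b' (t - t0) * (L b' \<bullet> b)) *\<^sub>R b)) (at t)"
      unfolding y_def[abs_def]
      by (intro has_vector_derivative_sum bounded_linear.has_vector_derivative[OF bounded_linear_scaleR_left])
    also have "(\<Sum>b\<in>Basis. (\<Sum>b'\<in>Basis. f b' (t - t0) * (L b' \<bullet> b)) *\<^sub>R b) = (\<Sum>b\<in>Basis. (L (y t) \<bullet> b) *\<^sub>R b)"
      by (subst Lb) (simp add: yb)
    finally show "(y has_vector_derivative L (y t)) (at t)" by (simp add: euclidean_representation)
  qed
qed

lemma continuous_on_if_has_vector_derivative:
  assumes "\<And>t. (f has_vector_derivative f' t) (at t)"
  shows "continuous_on S f"
proof (rule continuous_at_imp_continuous_on, rule ballI)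
  show "isCont f t" for t using has_vector_derivative_continuous[OF assms[of t]] .
qed

lemma adjoint_euclidean:
  fixes L :: "'a::euclidean_space \<Rightarrow> 'b::euclidean_space"
  assumes "linear L"
  shows "linear (adjoint L)" and "adjoint L y \<bullet> x = y \<bullet> L x" and "x \<bullet> adjoint L y = L x \<bullet> y"
  using assms by (simp_all add: adjoint_linear adjoint_works inner_commute)

text \<open>
  In the derivative of \<open>p \<bullet> z\<close> the two contributions of \<open>A\<close> cancel. This replaces the variation of
  constants formula: to learn about \<open>w \<bullet> z b\<close>, one takes the costate \<open>p\<close> with final value \<open>w\<close>.
\<close>

lemma costate_pairing_constant:
  fixes A :: "'a::euclidean_space \<Rightarrow> 'a"
  assumes A: "linear A" and ab: "a \<le> b" and z: "abs_cont_on a b z"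
    and dz: "AE t in lebesgue. t \<in> {a..b} \<longrightarrow>
      (z has_vector_derivative A (z t) + g t) (at t within {a..b})"
    and dp: "\<And>t. (p has_vector_derivative - adjoint A (p t)) (at t)"
    and pg: "AE t in lebesgue. t \<in> {a..b} \<longrightarrow> p t \<bullet> g t = 0"
  shows "p b \<bullet> z b = p a \<bullet> z a"
proof (rule abs_cont_on_zero_derivative_imp_eq[OF _ ab])
  have "continuous_on {a..b} p"
    by (rule continuous_on_if_has_vector_derivative[OF dp])
  then have "continuous_on {a..b} (\<lambda>t. - adjoint A (p t))"
    by (intro continuous_on_minus linear_continuous_on_compose[OF _ adjoint_euclidean(1)[OF A]])
  then have "abs_cont_on a b p" by (rule abs_cont_on_if_continuous_derivative[OF dp])
  then show "abs_cont_on a b (\<lambda>t. p t \<bullet> z t)" using z by (rule abs_cont_on_inner)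
  show "AE t in lebesgue. t \<in> {a..b} \<longrightarrow>
      ((\<lambda>t. p t \<bullet> z t) has_vector_derivative 0) (at t within {a..b})"
    using dz pg
  proof eventually_elim
    case (elim t)
    show ?case
    proof
      assume t: "t \<in> {a..b}"
      have "((\<lambda>t. p t \<bullet> z t) has_vector_derivative
          (p t \<bullet> (A (z t) + g t) + (- adjoint A (p t)) \<bullet> z t)) (at t within {a..b})"
        using elim t
        by (intro bounded_bilinear.has_vector_derivative[OF bounded_bilinear_inner]
            has_vector_derivative_at_within[OF dp]) auto
      then show "((\<lambda>t. p t \<bullet> z t) has_vector_derivative 0) (at t within {a..b})"
        using elim t by (simp add: inner_add_right adjoint_euclidean[OF A])
    qed
  qed
qed

lemma linear_ode_zero_unique:
  fixes A :: "'a::euclidean_space \<Rightarrow> 'a"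
  assumes A: "linear A" and z: "abs_cont_on a b z" and z0: "z a = 0"
    and dz: "AE t in lebesgue. t \<in> {a..b} \<longrightarrow> (z has_vector_derivative A (z t)) (at t within {a..b})"
    and c: "c \<in> {a..b}"
  shows "z c = 0"
proof -
  have sub: "{a..c} \<subseteq> {a..b}" using c by auto
  obtain p where p: "p c = z c" "\<And>t. (p has_vector_derivative - adjoint A (p t)) (at t)"
    using linear_flow_exists[OF linear_compose_neg[OF adjoint_euclidean(1)[OF A]], of c "z c"] by blast
  have "p c \<bullet> z c = p a \<bullet> z a"
  proof (rule costate_pairing_constant[OF A _ _ _ p(2), where g = "\<lambda>_. 0"])
    show "abs_cont_on a c z" using z sub by (rule abs_cont_on_subset)
    show "AE t in lebesgue. t \<in> {a..c} \<longrightarrow> (z has_vector_derivative A (z t) + 0) (at t within {a..c})"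
      using dz by eventually_elim (use sub in \<open>auto intro!: has_vector_derivative_within_subset[OF _ sub]\<close>)
  qed (use c in auto)
  then show ?thesis using p(1) z0 by simp
qed

text \<open>
  A state that is reached with an integrable control is also reached with a continuous one, namely
  \<open>adjoint B \<circ> p\<close> for a costate \<open>p\<close>. The endpoints reached in this way from \<open>0\<close> form a subspace. If
  \<open>w\<close> is orthogonal to it, then the costate with final value \<open>w\<close> has \<open>adjoint B (p t) = 0\<close> for all
  \<open>t\<close>, because the pairing of \<open>p\<close> with the state that it generates has derivative
  \<open>norm (adjoint B (p t))^2\<close>. Such a costate does not see any control, so \<open>w\<close> is orthogonal to every
  endpoint reached from \<open>0\<close>.
\<close>

lemma reachable_by_costate_control:
  fixes A :: "'a::euclidean_space \<Rightarrow> 'a" and B :: "'u::euclidean_space \<Rightarrow> 'a"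
  assumes A: "linear A" and B: "linear B" and ab: "a \<le> b" and z: "abs_cont_on a b z"
    and dz: "AE t in lebesgue. t \<in> {a..b} \<longrightarrow>
      (z has_vector_derivative A (z t) + B (u t)) (at t within {a..b})"
  obtains x p where "x a = z a" "x b = z b"
    "\<And>t. (x has_vector_derivative A (x t) + B (adjoint B (p t))) (at t)"
    "\<And>t. (p has_vector_derivative - adjoint A (p t)) (at t)"
proof -
  define sol where "sol x p \<longleftrightarrow> (\<forall>t. (x has_vector_derivative A (x t) + B (adjoint B (p t))) (at t)) \<and>
      (\<forall>t. (p has_vector_derivative - adjoint A (p t)) (at t))" for x p
  define V where "V = {x b | x p. sol x p \<and> x a = 0}"
  note lin = A B adjoint_euclidean(1)[OF A] adjoint_euclidean(1)[OF B]
  have sol_lincomb: "sol (\<lambda>t. r *\<^sub>R x t + s *\<^sub>R x' t) (\<lambda>t. r *\<^sub>R p t + s *\<^sub>R p' t)"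
    if "sol x p" "sol x' p'" for x x' p p' r s
    unfolding sol_def
  proof (intro conjI allI)
    fix t
    have x: "(x has_vector_derivative A (x t) + B (adjoint B (p t))) (at t)"
      "(x' has_vector_derivative A (x' t) + B (adjoint B (p' t))) (at t)"
      and p: "(p has_vector_derivative - adjoint A (p t)) (at t)"
      "(p' has_vector_derivative - adjoint A (p' t)) (at t)"
      using that unfolding sol_def by blast+
    note sc = bounded_linear.has_vector_derivative[OF bounded_linear_scaleR_right]
    from has_vector_derivative_add[OF sc[OF x(1), of r] sc[OF x(2), of s]]
    show "((\<lambda>t. r *\<^sub>R x t + s *\<^sub>R x' t) has_vector_derivative
        A (r *\<^sub>R x t + s *\<^sub>R x' t) + B (adjoint B (r *\<^sub>R p t + s *\<^sub>R p' t))) (at t)"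
      by (simp add: linear_add[OF lin(1)] linear_add[OF lin(2)] linear_add[OF lin(4)]
          linear_cmul[OF lin(1)] linear_cmul[OF lin(2)] linear_cmul[OF lin(4)] algebra_simps)
    from has_vector_derivative_add[OF sc[OF p(1), of r] sc[OF p(2), of s]]
    show "((\<lambda>t. r *\<^sub>R p t + s *\<^sub>R p' t) has_vector_derivative
        - adjoint A (r *\<^sub>R p t + s *\<^sub>R p' t)) (at t)"
      by (simp add: linear_add[OF lin(3)] linear_cmul[OF lin(3)])
  qed
  have sol0: "sol (\<lambda>_. 0) (\<lambda>_. 0)"
    by (simp add: sol_def linear_0[OF lin(1)] linear_0[OF lin(2)] linear_0[OF lin(3)] linear_0[OF lin(4)])
  have VI: "v \<in> V" if "sol x p" "x a = 0" "x b = v" for x p v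
    using that unfolding V_def by blast
  have V: "subspace V"
    unfolding subspace_def
  proof (intro conjI ballI allI)
    show "0 \<in> V" using sol0 by (rule VI) simp_all
    fix v v' assume "v \<in> V" "v' \<in> V"
    then obtain x p x' p' where "sol x p" "x a = 0" "v = x b" "sol x' p'" "x' a = 0" "v' = x' b"
      unfolding V_def by blast
    then show "v + v' \<in> V"
      by (intro VI[OF sol_lincomb[of x p x' p' 1 1]]) simp_all
  next
    fix r v assume "v \<in> V"
    then obtain x p where "sol x p" "x a = 0" "v = x b" unfolding V_def by blast
    then show "r *\<^sub>R v \<in> V"
      by (intro VI[OF sol_lincomb[of x p x p r 0]]) simp_all
  qed
  have sol_free: "sol x (\<lambda>_. 0)" if "\<And>t. (x has_vector_derivative A (x t)) (at t)" for x
    using that by (simp add: sol_def linear_0[OF lin(2)] linear_0[OF lin(3)] linear_0[OF lin(4)])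
  obtain h where h: "h a = z a" "\<And>t. (h has_vector_derivative A (h t)) (at t)"
    using linear_flow_exists[OF A] by blast
  have orth: "w \<bullet> (z b - h b) = 0" if w: "\<And>v. v \<in> V \<Longrightarrow> w \<bullet> v = 0" for w
  proof -
    (* the Hamiltonian system, solved backwards from the costate w; the state part is then shifted
       by a free motion so that it starts at 0 *)
    define H where "H = (\<lambda>(x, p). (A x + B (adjoint B p), - adjoint A p))"
    have "linear H"
      unfolding H_def
      by (rule linearI) (auto simp: linear_add[OF lin(1)] linear_add[OF lin(2)] linear_add[OF lin(3)]
          linear_add[OF lin(4)] linear_cmul[OF lin(1)] linear_cmul[OF lin(2)]
          linear_cmul[OF lin(3)] linear_cmul[OF lin(4)] algebra_simps)
    then obtain y where y: "y b = (0, w)" "\<And>t. (y has_vector_derivative H (y t)) (at t)"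
      using linear_flow_exists by blast
    define q where "q = (\<lambda>t. snd (y t))"
    have "sol (\<lambda>t. fst (y t)) q"
      unfolding sol_def q_def
    proof (intro conjI allI)
      fix t
      show "((\<lambda>t. fst (y t)) has_vector_derivative A (fst (y t)) + B (adjoint B (snd (y t)))) (at t)"
        using bounded_linear.has_vector_derivative[OF bounded_linear_fst y(2)[of t]]
        by (simp add: H_def split_def)
      show "((\<lambda>t. snd (y t)) has_vector_derivative - adjoint A (snd (y t))) (at t)"
        using bounded_linear.has_vector_derivative[OF bounded_linear_snd y(2)[of t]]
        by (simp add: H_def split_def)
    qed
    moreover obtain h' where h': "h' a = fst (y a)" "\<And>t. (h' has_vector_derivative A (h' t)) (at t)"
      using linear_flow_exists[OF A] by blast
    ultimately have "sol (\<lambda>t. 1 *\<^sub>R fst (y t) + (-1) *\<^sub>R h' t) (\<lambda>t. 1 *\<^sub>R q t + (-1) *\<^sub>R 0)"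
      by (intro sol_lincomb sol_free)
    then have s: "sol (\<lambda>t. fst (y t) - h' t) q" (is "sol ?x q") by simp
    have dq: "\<And>t. (q has_vector_derivative - adjoint A (q t)) (at t)" using s by (simp add: sol_def)
    have "?x a = 0" using h' by simp
    then have "?x b \<in> V" using VI[OF s] by simp
    then have end0: "q b \<bullet> ?x b = 0" using w[of "?x b"] y(1) unfolding q_def by (simp only: snd_conv)
    have dpair: "((\<lambda>t. q t \<bullet> ?x t) has_real_derivative (norm (adjoint B (q t)))\<^sup>2) (at t)" for t
    proof -
      have "(?x has_vector_derivative A (?x t) + B (adjoint B (q t))) (at t)"
        using s by (simp add: sol_def)
      from bounded_bilinear.has_vector_derivative[OF bounded_bilinear_inner dq this]
      have "((\<lambda>t. q t \<bullet> ?x t) has_vector_derivative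
          q t \<bullet> (A (?x t) + B (adjoint B (q t))) + (- adjoint A (q t)) \<bullet> ?x t) (at t)" .
      also have "q t \<bullet> (A (?x t) + B (adjoint B (q t))) + (- adjoint A (q t)) \<bullet> ?x t
          = (norm (adjoint B (q t)))\<^sup>2"
        by (simp add: inner_add_right adjoint_euclidean(2)[OF A] power2_norm_eq_inner
            adjoint_euclidean(2)[OF B])
      finally show ?thesis by (simp add: has_real_derivative_iff_has_vector_derivative)
    qed
    have mono: "q s \<bullet> ?x s \<le> q t \<bullet> ?x t" if "s \<le> t" for s t
      by (rule DERIV_nonneg_imp_nondecreasing[OF that]) (use dpair zero_le_power2 in blast)
    have zero: "q t \<bullet> ?x t = 0" if "t \<in> {a..b}" for t
      using mono[of a t] mono[of t b] that end0 \<open>?x a = 0\<close> by simp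
    have Bq: "adjoint B (q t) = 0" if t: "t \<in> {a<..<b}" for t
    proof -
      have "((\<lambda>t. q t \<bullet> ?x t) has_real_derivative 0) (at t)"
      proof (rule has_field_derivative_transform_within_open[where f = "\<lambda>_. 0" and S = "{a<..<b}"])
        show "0 = q t \<bullet> ?x t" if "t \<in> {a<..<b}" for t using zero[of t] that by simp
      qed (use t in auto)
      from DERIV_unique[OF this dpair[of t]] show ?thesis by simp
    qed
    have "q b \<bullet> (1 *\<^sub>R z b + (-1) *\<^sub>R h b) = q a \<bullet> (1 *\<^sub>R z a + (-1) *\<^sub>R h a)"
    proof (rule costate_pairing_constant[OF A ab _ _ dq, where g = "\<lambda>t. B (u t)"])
      have "continuous_on {a..b} h"
        by (rule continuous_on_if_has_vector_derivative[OF h(2)])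
      then have "abs_cont_on a b h"
        by (intro abs_cont_on_if_continuous_derivative[OF h(2)] linear_continuous_on_compose[OF _ A])
      then show "abs_cont_on a b (\<lambda>t. 1 *\<^sub>R z t + (-1) *\<^sub>R h t)"
        by (intro abs_cont_on_lincomb z)
      show "AE t in lebesgue. t \<in> {a..b} \<longrightarrow> ((\<lambda>t. 1 *\<^sub>R z t + (-1) *\<^sub>R h t) has_vector_derivative
          A (1 *\<^sub>R z t + (-1) *\<^sub>R h t) + B (u t)) (at t within {a..b})"
        using dz
      proof eventually_elim
        case (elim t)
        have "((\<lambda>t. z t - h t) has_vector_derivative (A (z t) + B (u t)) - A (h t)) (at t within {a..b})"
          if "t \<in> {a..b}"
          using elim that by (intro has_vector_derivative_diff has_vector_derivative_at_within[OF h(2)]) auto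
        then show ?case by (simp add: linear_diff[OF A] algebra_simps)
      qed
      have "AE t in lebesgue. t \<noteq> a" "AE t in lebesgue. t \<noteq> b"
        by (auto intro!: AE_I'[of "{_}"] negligible_iff_null_sets[THEN iffD1])
      then show "AE t in lebesgue. t \<in> {a..b} \<longrightarrow> q t \<bullet> B (u t) = 0"
      proof eventually_elim
        case (elim t)
        then show ?case
          using Bq[of t] adjoint_euclidean(2)[OF B, of "q t" "u t"] by (auto simp: less_le)
      qed
    qed
    then show ?thesis using y(1) h(1) by (simp add: q_def)
  qed
  have "z b - h b \<in> V"
  proof -
    obtain v w where "v \<in> span V" "\<And>x. x \<in> span V \<Longrightarrow> orthogonal w x" "z b - h b = v + w"
      using orthogonal_subspace_decomp_exists by blast
    moreover have "span V = V" using V by (simp add: span_eq_iff)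
    ultimately have vw: "v \<in> V" "\<And>x. x \<in> V \<Longrightarrow> w \<bullet> x = 0" "z b - h b = v + w"
      by (auto simp: orthogonal_def)
    then have "w \<bullet> w = 0" using orth[OF vw(2)] by (simp add: inner_add_right)
    then show ?thesis using vw by simp
  qed
  then obtain x p where xp: "sol x p" "x a = 0" "x b = z b - h b"
    unfolding V_def by auto
  have "sol (\<lambda>t. 1 *\<^sub>R x t + 1 *\<^sub>R h t) (\<lambda>t. 1 *\<^sub>R p t + 1 *\<^sub>R 0)"
    by (intro sol_lincomb sol_free h xp)
  then have "sol (\<lambda>t. x t + h t) p" by simp
  then show thesis
    using xp h(1) by (intro that[of "\<lambda>t. x t + h t" p]) (auto simp: sol_def)
qed

section \<open>Matrices over the real or complex numbers as real linear maps\<close>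

text \<open>
  With respect to the real inner product, which is the real part of the Hermitian form, the conjugate
  transpose is the adjoint. This makes it possible to treat both fields at once by real linear
  algebra. The lemma below is the scalar case; as the embedding into the complex numbers preserves
  norms, it preserves inner products by polarization.
\<close>

lemma inner_mult_conjugate:
  fixes a x y :: "'k::real_or_complex"
  shows "(a * x) \<bullet> y = x \<bullet> (conjugate a * y)"
proof -
  obtain h :: "'k \<Rightarrow> complex" where h: "\<And>x y. h (x + y) = h x + h y" "\<And>x y. h (x * y) = h x * h y"
    "\<And>x. norm (h x) = norm x" "\<And>x. h (conjugate x) = cnj (h x)"
    using real_or_complex_iso[where 'a = 'k] by blast
  have inner_h: "x \<bullet> y = h x \<bullet> h y" for x y
    by (simp only: dot_norm h(1)[symmetric] h(3))
  show ?thesis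
    unfolding inner_h h by (simp add: inner_complex_def algebra_simps)
qed

lemma conjugate_mult_self:
  fixes a :: "'k::real_or_complex"
  shows "conjugate a * a = of_real ((norm a)\<^sup>2)"
proof -
  obtain h :: "'k \<Rightarrow> complex" where h: "\<And>x y. h (x + y) = h x + h y" "\<And>x y. h (x * y) = h x * h y"
    "\<And>r x. h (r *\<^sub>R x) = r *\<^sub>R h x" "\<And>x. norm (h x) = norm x" "\<And>x. h (conjugate x) = cnj (h x)"
    using real_or_complex_iso[where 'a = 'k] by blast
  have h1: "h 1 = 1"
  proof -
    have "h 1 * h 1 = h 1 * 1" using h(2)[of 1 1] by simp
    moreover have "h 1 \<noteq> 0" using h(4)[of 1] by auto
    ultimately show ?thesis by simp
  qed
  have "h (conjugate a * a) = cnj (h a) * h a" by (simp only: h)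
  also have "\<dots> = of_real ((norm a)\<^sup>2)"
    using complex_norm_square[of "h a"] by (simp only: h(4) mult.commute[of "cnj (h a)"])
  also have "\<dots> = h (of_real ((norm a)\<^sup>2))"
    by (simp only: of_real_def h(3) h1)
  finally have "h (conjugate a * a) = h (of_real ((norm a)\<^sup>2))" .
  moreover have "x = y" if "h x = h y" for x y
  proof -
    have "h (x - y) = 0" using h(1)[of "x - y" y] that by simp
    then show ?thesis using h(4)[of "x - y"] by simp
  qed
  ultimately show ?thesis by blast
qed

lemma conjugate_one: "conjugate (1 :: 'k::real_or_complex) = 1"
  using conjugate_mult_self[of "1::'k"] by simp

lemma inner_matrix_ctranspose:
  fixes A :: "'k::real_or_complex^'c^'r"
  shows "(A *v x) \<bullet> y = x \<bullet> (A\<^sup>H *v y)"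
proof -
  have "(A *v x) \<bullet> y = (\<Sum>i\<in>UNIV. \<Sum>j\<in>UNIV. x $ j \<bullet> (conjugate (A $ i $ j) * y $ i))"
    by (simp add: inner_vec_def matrix_vector_mult_def inner_sum_left inner_mult_conjugate)
  also have "\<dots> = (\<Sum>j\<in>UNIV. \<Sum>i\<in>UNIV. x $ j \<bullet> (conjugate (A $ i $ j) * y $ i))"
    by (rule sum.swap)
  also have "\<dots> = x \<bullet> (A\<^sup>H *v y)"
    by (simp add: inner_vec_def matrix_vector_mult_def inner_sum_right ctranspose_def)
  finally show ?thesis .
qed

lemma adjoint_matrix_vector_mult:
  fixes A :: "'k::real_or_complex^'c^'r"
  shows "adjoint ((*v) A) = (*v) (A\<^sup>H)"
  by (rule adjoint_unique) (simp add: inner_matrix_ctranspose)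

lemma inner_hermitian:
  fixes A :: "'k::real_or_complex^'n^'n"
  assumes "A = A\<^sup>H"
  shows "(A *v x) \<bullet> y = x \<bullet> (A *v y)"
  using inner_matrix_ctranspose[of A x y] assms by simp

lemma qform_inner_one:
  fixes A :: "'k::real_or_complex^'n^'n"
  shows "qform A x \<bullet> 1 = (A *v x) \<bullet> x"
proof -
  have "(conjugate a * b) \<bullet> 1 = b \<bullet> a" for a b :: 'k
    by (simp add: inner_mult_conjugate)
  then show ?thesis by (simp add: qform_def inner_sum_left inner_vec_def)
qed

lemma psd_inner_nonneg:
  fixes A :: "'k::real_or_complex^'n^'n"
  assumes "psd A"
  shows "0 \<le> (A *v x) \<bullet> x"
proof -
  obtain r where "r \<ge> 0" "qform A x = of_real r"
    using assms unfolding psd_def by (metis nonneg_Reals_cases)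
  then show ?thesis by (simp add: qform_inner_one[symmetric] of_real_def)
qed

text \<open>
  The form at \<open>x - t (A x)\<close> equals \<open>- 2 t (norm (A x))\<^sup>2 + O(t\<^sup>2)\<close>, which would be negative for
  small \<open>t > 0\<close> if \<open>A x \<noteq> 0\<close>.
\<close>

lemma hermitian_psd_inner_eq_0_imp:
  fixes A :: "'k::real_or_complex^'n^'n"
  assumes herm: "A = A\<^sup>H" and "psd A" and 0: "(A *v x) \<bullet> x = 0"
  shows "A *v x = 0"
proof (rule ccontr)
  assume "A *v x \<noteq> 0"
  define y where "y = A *v x"
  define a where "a = y \<bullet> y"
  define b where "b = (A *v y) \<bullet> y"
  have "a > 0" using \<open>A *v x \<noteq> 0\<close> by (simp add: a_def y_def)
  have "b \<ge> 0" using psd_inner_nonneg[OF \<open>psd A\<close>] by (simp add: b_def)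
  have ineq: "0 \<le> t * (t * b - 2 * a)" for t :: real
  proof -
    have "(A *v (x - t *\<^sub>R y)) \<bullet> (x - t *\<^sub>R y) = t * (t * b - 2 * a)"
      using 0 inner_hermitian[OF herm, of y x]
      by (simp add: matrix_vector_mult_diff_distrib linear_cmul[OF matrix_vector_mul_linear]
          inner_diff_left inner_diff_right a_def b_def y_def[symmetric] inner_commute algebra_simps)
    then show ?thesis using psd_inner_nonneg[OF \<open>psd A\<close>] by metis
  qed
  define t where "t = a / (b + 1)"
  have "t > 0" using \<open>a > 0\<close> \<open>b \<ge> 0\<close> by (simp add: t_def)
  have "t * b \<le> a" using \<open>a > 0\<close> \<open>b \<ge> 0\<close> by (simp add: t_def field_simps)
  then have "t * (t * b - 2 * a) < 0" using \<open>t > 0\<close> \<open>a > 0\<close> by (intro mult_pos_neg) auto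
  then show False using ineq[of t] by simp
qed

lemma inner_QRQ:
  fixes Q R :: "'k::real_or_complex^'n^'n"
  assumes "Q = Q\<^sup>H"
  shows "((Q ** R ** Q) *v x) \<bullet> y = (R *v (Q *v x)) \<bullet> (Q *v y)"
  using inner_hermitian[OF assms, of "R *v (Q *v x)" y]
  by (simp add: matrix_vector_mul_assoc[symmetric])

section \<open>Regularity of the pencil\<close>

text \<open>
  Suppose that the system has a nontrivial solution for every large \<open>s\<close>. For such \<open>s\<close> the first two
  equations determine \<open>x\<close> and \<open>l\<close> from \<open>u\<close>, so \<open>u \<noteq> 0\<close>; after scaling, \<open>u\<close> has norm one, and along a
  sequence \<open>s \<rightarrow> \<infinity>\<close> it converges to some \<open>u'\<close> of norm one. The first two equations give
  \<open>s x \<rightarrow> B u'\<close> and \<open>s\<^sup>2 l \<rightarrow> - W (B u')\<close>. The third one gives \<open>S u' = 0\<close> in the limit; therefore,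
  tested with \<open>u'\<close>, it says \<open>l \<bullet> B u' = 0\<close>, and multiplying by \<open>s\<^sup>2\<close> gives
  \<open>W (B u') \<bullet> B u' = 0\<close> in the limit. So \<open>u' = 0\<close>, a contradiction.
\<close>

lemma optimality_system_trivial_kernel:
  fixes A W :: "'x::euclidean_space \<Rightarrow> 'x" and B :: "'u::euclidean_space \<Rightarrow> 'x" and S :: "'u \<Rightarrow> 'u"
  assumes A: "linear A" and W: "linear W" and B: "linear B" and S: "linear S"
    and symS: "\<And>u v. S u \<bullet> v = u \<bullet> S v"
    and inj: "\<And>u. S u = 0 \<Longrightarrow> W (B u) \<bullet> B u = 0 \<Longrightarrow> u = 0"
  obtains s :: real where
    "\<And>l x u. s *\<^sub>R x = A x + B u \<Longrightarrow> s *\<^sub>R l + adjoint A l + W x = 0 \<Longrightarrow>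
        adjoint B l + S u = 0 \<Longrightarrow> l = 0 \<and> x = 0 \<and> u = 0"
proof (rule ccontr)
  assume "\<not> thesis"
  then have ex: "\<exists>l x u. s *\<^sub>R x = A x + B u \<and> s *\<^sub>R l + adjoint A l + W x = 0 \<and>
        adjoint B l + S u = 0 \<and> \<not> (l = 0 \<and> x = 0 \<and> u = 0)" for s :: real
    using that by blast
  have lA': "linear (adjoint A)" and lB': "linear (adjoint B)"
    using A B by (simp_all add: adjoint_linear)
  obtain C1 where C1: "C1 > 0" "\<And>x. norm (A x) \<le> C1 * norm x" using linear_bounded_pos[OF A] by blast
  obtain C2 where C2: "C2 > 0" "\<And>x. norm (adjoint A x) \<le> C2 * norm x" using linear_bounded_pos[OF lA'] by blast
  obtain CB where CB: "CB > 0" "\<And>x. norm (B x) \<le> CB * norm x" using linear_bounded_pos[OF B] by blast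
  obtain CW where CW: "CW > 0" "\<And>x. norm (W x) \<le> CW * norm x" using linear_bounded_pos[OF W] by blast
  (* large enough to dominate A and its adjoint with a margin that tends to infinity *)
  define s where "s n = C1 + C2 + real (Suc n)" for n
  have sx: "real (Suc n) * norm x \<le> norm (s n *\<^sub>R x - A x)" for n x
  proof -
    have "real (Suc n) * norm x \<le> s n * norm x - C1 * norm x"
      using C2(1) by (simp add: s_def algebra_simps)
    also have "\<dots> \<le> norm (s n *\<^sub>R x) - norm (A x)"
      using C1 C2 by (simp add: s_def)
    also have "\<dots> \<le> norm (s n *\<^sub>R x - A x)" by (rule norm_triangle_ineq2)
    finally show ?thesis .
  qed
  have sl: "real (Suc n) * norm l \<le> norm (s n *\<^sub>R l + adjoint A l)" for n l
  proof -
    have "real (Suc n) * norm l \<le> s n * norm l - C2 * norm l"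
      using C1(1) by (simp add: s_def algebra_simps)
    also have "\<dots> \<le> norm (s n *\<^sub>R l) - norm (adjoint A l)"
      using C1 C2 by (simp add: s_def)
    also have "\<dots> \<le> norm (s n *\<^sub>R l - (- adjoint A l))"
      using norm_triangle_ineq2[of "s n *\<^sub>R l" "- adjoint A l"] by simp
    finally show ?thesis by simp
  qed
  have "\<exists>l x u. s n *\<^sub>R x = A x + B u \<and> s n *\<^sub>R l + adjoint A l + W x = 0 \<and>
        adjoint B l + S u = 0 \<and> norm u = 1" for n
  proof -
    obtain l x u where e: "s n *\<^sub>R x = A x + B u" "s n *\<^sub>R l + adjoint A l + W x = 0"
      "adjoint B l + S u = 0" "\<not> (l = 0 \<and> x = 0 \<and> u = 0)" using ex[of "s n"] by blast
    have "u \<noteq> 0"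
    proof
      assume "u = 0"
      then have "real (Suc n) * norm x \<le> 0" using sx[of n x] e(1) by (simp add: linear_0[OF B])
      then have "x = 0" by (simp add: mult_le_0_iff)
      then have "real (Suc n) * norm l \<le> 0" using sl[of n l] e(2) by (simp add: linear_0[OF W])
      then have "l = 0" by (simp add: mult_le_0_iff)
      with e(4) \<open>u = 0\<close> \<open>x = 0\<close> show False by simp
    qed
    define r where "r = inverse (norm u)"
    have "s n *\<^sub>R (r *\<^sub>R x) = A (r *\<^sub>R x) + B (r *\<^sub>R u)"
      using arg_cong[OF e(1), of "(*\<^sub>R) r"]
      by (simp add: linear_cmul[OF A] linear_cmul[OF B] algebra_simps)
    moreover have "s n *\<^sub>R (r *\<^sub>R l) + adjoint A (r *\<^sub>R l) + W (r *\<^sub>R x) = 0"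
      using arg_cong[OF e(2), of "(*\<^sub>R) r"]
      by (simp add: linear_cmul[OF lA'] linear_cmul[OF W] algebra_simps)
    moreover have "adjoint B (r *\<^sub>R l) + S (r *\<^sub>R u) = 0"
      using arg_cong[OF e(3), of "(*\<^sub>R) r"]
      by (simp add: linear_cmul[OF lB'] linear_cmul[OF S] algebra_simps)
    moreover have "norm (r *\<^sub>R u) = 1" using \<open>u \<noteq> 0\<close> by (simp add: r_def)
    ultimately show ?thesis by blast
  qed
  then obtain l x u where e1: "\<And>n. s n *\<^sub>R x n = A (x n) + B (u n)"
    and e2: "\<And>n. s n *\<^sub>R l n + adjoint A (l n) + W (x n) = 0"
    and e3: "\<And>n. adjoint B (l n) + S (u n) = 0" and e4: "\<And>n. norm (u n) = 1"
    by metis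
  have "compact (sphere (0::'u) 1)" by simp
  moreover have "\<forall>n. u n \<in> sphere 0 1" using e4 by simp
  ultimately obtain u' r where u': "u' \<in> sphere 0 1" and r: "strict_mono (r :: nat \<Rightarrow> nat)"
    and lim_u: "(u \<circ> r) \<longlonglongrightarrow> u'"
    unfolding compact_def by blast
  have tends: "(\<lambda>n. f (z n)) \<longlonglongrightarrow> f z'" if "linear f" "z \<longlonglongrightarrow> z'" for f :: "'p::euclidean_space \<Rightarrow> 'q::euclidean_space" and z z'
    using that linear_continuous_at[of f z'] by (auto simp: linear_conv_bounded_linear isCont_tendsto_compose)
  have inv0: "(\<lambda>n. K * inverse (real (Suc n))) \<longlonglongrightarrow> 0" for K
    using tendsto_mult_right_zero[OF LIMSEQ_inverse_real_of_nat, of K] .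
  have nx: "norm (x n) \<le> CB * inverse (real (Suc n))" for n
  proof -
    have "real (Suc n) * norm (x n) \<le> norm (B (u n))" using sx[of n "x n"] e1[of n] by simp
    also have "\<dots> \<le> CB" using CB(2)[of "u n"] e4[of n] by simp
    finally show ?thesis by (simp add: field_simps)
  qed
  have nl: "norm (l n) \<le> (CW * CB) * inverse (real (Suc n))" for n
  proof -
    have "norm (s n *\<^sub>R l n + adjoint A (l n)) = norm (W (x n))"
      using e2[of n] by (metis add_eq_0_iff norm_minus_cancel)
    then have "real (Suc n) * norm (l n) \<le> norm (W (x n))" using sl[of n "l n"] by simp
    also have "\<dots> \<le> CW * (CB * inverse (real (Suc n)))"
      using CW(2)[of "x n"] mult_left_mono[OF nx[of n], of CW] CW(1) by linarith
    also have "\<dots> \<le> CW * (CB * 1)"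
      using CW(1) CB(1) by (intro mult_left_mono) (auto simp: field_simps)
    finally show ?thesis by (simp add: field_simps)
  qed
  have x0: "x \<longlonglongrightarrow> 0" by (rule Lim_null_comparison[OF _ inv0[of CB]]) (intro always_eventually allI nx)
  have l0: "l \<longlonglongrightarrow> 0" by (rule Lim_null_comparison[OF _ inv0[of "CW * CB"]]) (intro always_eventually allI nl)
  define X where "X = x \<circ> r"
  define L where "L = l \<circ> r"
  define U where "U = u \<circ> r"
  define \<sigma> where "\<sigma> = s \<circ> r"
  have X: "X \<longlonglongrightarrow> 0" and L: "L \<longlonglongrightarrow> 0" and U: "U \<longlonglongrightarrow> u'"
    using x0 l0 lim_u r by (simp_all add: X_def L_def U_def LIMSEQ_subseq_LIMSEQ)
  have e1: "\<sigma> n *\<^sub>R X n = A (X n) + B (U n)" and e2: "\<sigma> n *\<^sub>R L n + adjoint A (L n) + W (X n) = 0"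
    and e3: "adjoint B (L n) + S (U n) = 0" for n
    unfolding X_def L_def U_def \<sigma>_def comp_apply by (rule e1 e2 e3)+
  have "(\<lambda>n. adjoint B (L n) + S (U n)) \<longlonglongrightarrow> adjoint B 0 + S u'"
    by (rule tendsto_add[OF tends[OF lB' L] tends[OF S U]])
  then have Su': "S u' = 0" unfolding e3 by (simp add: linear_0[OF lB'] LIMSEQ_const_iff)
  have "(\<lambda>n. A (X n) + B (U n)) \<longlonglongrightarrow> A 0 + B u'" by (rule tendsto_add[OF tends[OF A X] tends[OF B U]])
  then have sX: "(\<lambda>n. \<sigma> n *\<^sub>R X n) \<longlonglongrightarrow> B u'" by (simp add: e1 linear_0[OF A])
  have sLeq: "\<sigma> n *\<^sub>R L n = - adjoint A (L n) - W (X n)" for n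
    using e2[of n] by (simp add: algebra_simps eq_neg_iff_add_eq_0)
  have "(\<lambda>n. - adjoint A (L n) - W (X n)) \<longlonglongrightarrow> - adjoint A 0 - W 0"
    by (rule tendsto_diff[OF tendsto_minus[OF tends[OF lA' L]] tends[OF W X]])
  then have sL: "(\<lambda>n. \<sigma> n *\<^sub>R L n) \<longlonglongrightarrow> 0" by (simp add: sLeq linear_0[OF lA'] linear_0[OF W])
  have ssLeq: "\<sigma> n *\<^sub>R \<sigma> n *\<^sub>R L n = - adjoint A (\<sigma> n *\<^sub>R L n) - W (\<sigma> n *\<^sub>R X n)" for n
    using arg_cong[OF sLeq[of n], of "(*\<^sub>R) (\<sigma> n)"]
    by (simp add: linear_cmul[OF lA'] linear_cmul[OF W] scaleR_diff_right)
  have "(\<lambda>n. - adjoint A (\<sigma> n *\<^sub>R L n) - W (\<sigma> n *\<^sub>R X n)) \<longlonglongrightarrow> - adjoint A 0 - W (B u')"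
    by (rule tendsto_diff[OF tendsto_minus[OF tends[OF lA' sL]] tends[OF W sX]])
  then have "(\<lambda>n. \<sigma> n *\<^sub>R \<sigma> n *\<^sub>R L n) \<longlonglongrightarrow> - W (B u')" by (simp only: ssLeq linear_0[OF lA'] diff_0 minus_zero)
  then have "(\<lambda>n. (\<sigma> n *\<^sub>R \<sigma> n *\<^sub>R L n) \<bullet> B u') \<longlonglongrightarrow> (- W (B u')) \<bullet> B u'"
    by (intro tendsto_inner tendsto_const)
  moreover have "(\<sigma> n *\<^sub>R \<sigma> n *\<^sub>R L n) \<bullet> B u' = 0" for n
  proof -
    have "L n \<bullet> B u' = adjoint B (L n) \<bullet> u'" using adjoint_works[OF B, of u' "L n"] by (simp add: inner_commute)
    also have "\<dots> = - (S (U n) \<bullet> u')" using e3[of n] by (simp add: eq_neg_iff_add_eq_0[symmetric] add_eq_0_iff)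
    also have "\<dots> = 0" using symS[of "U n" u'] Su' by simp
    finally show ?thesis by simp
  qed
  ultimately have "(\<lambda>n::nat. 0) \<longlonglongrightarrow> (- W (B u')) \<bullet> B u'" by (simp only:)
  then have "W (B u') \<bullet> B u' = 0" by (simp add: LIMSEQ_const_iff)
  then have "u' = 0" using inj Su' by blast
  with u' show False by simp
qed

lemma det_poly_eval:
  fixes M :: "'a::comm_ring_1 poly^'n^'n"
  shows "poly (det M) s = det (\<chi> i j. poly (M $ i $ j) s)"
  by (simp add: det_def poly_sum poly_prod)

lemma regular_pencil_if_trivial_kernel:
  fixes E A :: "'k::real_or_complex^'l^'l"
  assumes "\<And>v. s *s (E *v v) = A *v v \<Longrightarrow> v = 0"
  shows "regular_pencil E A"
proof -
  define M where "M = (\<chi> i j. s * E $ i $ j - A $ i $ j)"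
  have "v = 0" if "M *v v = 0" for v
  proof (rule assms, rule vec_eq_iff[THEN iffD2], rule allI)
    fix i
    have "(M *v v) $ i = (s *s (E *v v)) $ i - (A *v v) $ i"
      by (simp add: M_def matrix_vector_mult_def sum_subtractf[symmetric] sum_distrib_left algebra_simps)
    then show "(s *s (E *v v)) $ i = (A *v v) $ i" using that by simp
  qed
  then have "invertible M"
    by (meson invertible_left_inverse matrix_left_invertible_ker)
  then have "det M \<noteq> 0" by (simp add: invertible_det_nz)
  moreover have "poly (det (\<chi> i j. monom (E $ i $ j) 1 - [:A $ i $ j:])) s = det M"
    by (simp add: det_poly_eval poly_monom M_def mult.commute)
  ultimately show ?thesis unfolding regular_pencil_def by (metis poly_0)
qed

lemma sum_UNIV_Plus:
  fixes f :: "'a::finite + 'b::finite \<Rightarrow> 'c::comm_monoid_add"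
  shows "sum f UNIV = (\<Sum>i\<in>UNIV. f (Inl i)) + (\<Sum>j\<in>UNIV. f (Inr j))"
  unfolding UNIV_Plus_UNIV[symmetric] by (subst sum.Plus) (simp_all add: comp_def)

text \<open>
  The three equations are the block rows of \<open>(s \<E> - \<A>\<^sub>S) v = 0\<close> for \<open>v = (l, x, u)\<close>. A real point \<open>s\<close>
  suffices for regularity, and it makes the equations accessible to real linear algebra.
\<close>

lemma regular_optimality_pencil_if_trivial_kernel:
  fixes J R Q :: "'k::real_or_complex^'n^'n" and B :: "'k^'m^'n" and S :: "'k^'m^'m" and s :: real
  assumes "\<And>l x u. s *\<^sub>R x = ((J - R) ** Q) *v x + B *v u \<Longrightarrow>
      s *\<^sub>R l + (((J - R) ** Q)\<^sup>H) *v l + (Q ** R ** Q) *v x = 0 \<Longrightarrow>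
      (B\<^sup>H) *v l + S *v u = 0 \<Longrightarrow> l = 0 \<and> x = 0 \<and> u = 0"
  shows "regular_pencil E_pencil (A_pencil J R Q B S)"
proof (rule regular_pencil_if_trivial_kernel[where s = "of_real s"])
  fix v :: "'k^('n + 'n + 'm)"
  assume eq: "of_real s *s (E_pencil *v v) = A_pencil J R Q B S *v v"
  define l where "l = (\<chi> i. v $ Inl i)"
  define x where "x = (\<chi> i. v $ Inr (Inl i))"
  define u where "u = (\<chi> i. v $ Inr (Inr i))"
  have eqi: "of_real s * (E_pencil *v v) $ i = (A_pencil J R Q B S *v v) $ i" for i
    using arg_cong[OF eq, of "\<lambda>w. w $ i"] by simp
  have block: "((\<chi> i j. block3 A11 A12 A13 A21 A22 A23 A31 A32 A33 i j) *v v) $ Inl a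
        = (A11 *v l) $ a + (A12 *v x) $ a + (A13 *v u) $ a"
    "((\<chi> i j. block3 A11 A12 A13 A21 A22 A23 A31 A32 A33 i j) *v v) $ Inr (Inl a)
        = (A21 *v l) $ a + (A22 *v x) $ a + (A23 *v u) $ a"
    "((\<chi> i j. block3 A11 A12 A13 A21 A22 A23 A31 A32 A33 i j) *v v) $ Inr (Inr b)
        = (A31 *v l) $ b + (A32 *v x) $ b + (A33 *v u) $ b"
    for A11 A12 A13 A21 A22 A23 A31 A32 A33 a b
    by (simp_all add: matrix_vector_mult_def sum_UNIV_Plus l_def x_def u_def add.assoc)
  have "l = 0 \<and> x = 0 \<and> u = 0"
  proof (rule assms)
    show "s *\<^sub>R x = ((J - R) ** Q) *v x + B *v u"
      using eqi[of "Inl _"]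
      by (simp add: vec_eq_iff E_pencil_def A_pencil_def block scaleR_conv_of_real[where 'a = 'k])
    show "s *\<^sub>R l + (((J - R) ** Q)\<^sup>H) *v l + (Q ** R ** Q) *v x = 0"
    proof (rule vec_eq_iff[THEN iffD2], rule allI)
      fix a
      have "- (of_real s * l $ a) = ((((J - R) ** Q)\<^sup>H) *v l) $ a + ((Q ** R ** Q) *v x) $ a"
        using eqi[of "Inr (Inl a)"]
        using matrix_vector_mult_diff_rdistrib[of 0 "mat 1" l]
        by (simp add: E_pencil_def A_pencil_def block)
      then show "(s *\<^sub>R l + (((J - R) ** Q)\<^sup>H) *v l + (Q ** R ** Q) *v x) $ a = 0 $ a"
        by (simp add: scaleR_conv_of_real[where 'a = 'k] neg_eq_iff_add_eq_0 add.assoc)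
    qed
    show "(B\<^sup>H) *v l + S *v u = 0"
      using eqi[of "Inr (Inr _)"] by (simp add: vec_eq_iff E_pencil_def A_pencil_def block)
  qed
  then have "v $ Inl a = 0" "v $ Inr (Inl a) = 0" "v $ Inr (Inr b) = 0" for a b
    by (simp_all add: l_def x_def u_def vec_eq_iff)
  then show "v = 0"
    by (simp add: vec_eq_iff split_sum_all)
qed

lemma kernel_condition_inject:
  assumes "kernel_condition R Q B S" "S *v u = 0" "R *v (Q *v (B *v u)) = 0"
  shows "u = 0"
proof -
  have "B *v u \<in> (\<lambda>u. B *v u) ` mker S \<inter> mker (R ** Q)"
    using assms(2,3) by (auto simp: mker_def matrix_vector_mul_assoc[symmetric])
  then have "B *v u = 0" using assms(1) unfolding kernel_condition_def by blast
  then have "u \<in> mker B \<inter> mker S" using assms(2) by (simp add: mker_def)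
  then show ?thesis using assms(1) unfolding kernel_condition_def by blast
qed

lemma kernel_condition_imp_regular:
  fixes J R Q :: "'k::real_or_complex^'n^'n" and B :: "'k^'m^'n" and S :: "'k^'m^'m"
  assumes R: "R = R\<^sup>H" "psd R" and Q: "Q = Q\<^sup>H" and S: "S = S\<^sup>H"
    and ker: "kernel_condition R Q B S"
  shows "regular_pencil E_pencil (A_pencil J R Q B S)"
proof -
  have inj: "u = 0" if "S *v u = 0" "((Q ** R ** Q) *v (B *v u)) \<bullet> (B *v u) = 0" for u
    using kernel_condition_inject[OF ker that(1)] hermitian_psd_inner_eq_0_imp[OF R] that(2)
    unfolding inner_QRQ[OF Q] by blast
  show ?thesis
  proof (rule optimality_system_trivial_kernel[of "(*v) ((J - R) ** Q)" "(*v) (Q ** R ** Q)" "(*v) B" "(*v) S"])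
    fix s :: real
    assume "\<And>l x u. s *\<^sub>R x = ((J - R) ** Q) *v x + B *v u \<Longrightarrow>
      s *\<^sub>R l + adjoint ((*v) ((J - R) ** Q)) l + (Q ** R ** Q) *v x = 0 \<Longrightarrow>
      adjoint ((*v) B) l + S *v u = 0 \<Longrightarrow> l = 0 \<and> x = 0 \<and> u = 0"
    then show ?thesis
      unfolding adjoint_matrix_vector_mult by (rule regular_optimality_pencil_if_trivial_kernel)
  qed (use inner_hermitian[OF S] inj in auto)
qed

text \<open>
  A second state without control carries all the dissipation: with \<open>Q = I\<close>, \<open>S = 0\<close> and
  \<open>B = e\<^sub>1\<close>, the range of \<open>B\<close> lies in the kernel of \<open>R = diag(0, 1)\<close>, so the kernel condition fails.
  The skew coupling \<open>J\<close> feeds the first state into the dissipated one, and this suffices for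
  regularity; the pencil is invertible already at \<open>s = 0\<close>.
\<close>

lemma regular_without_kernel_condition:
  "\<exists>(J :: 'k::real_or_complex^2^2) (R :: 'k^2^2) (Q :: 'k^2^2) (B :: 'k^1^2) (S :: 'k^1^1).
     (J, R, Q, B) \<in> Sigma_pH \<and> S = S\<^sup>H \<and> psd S \<and>
     regular_pencil E_pencil (A_pencil J R Q B S) \<and> \<not> kernel_condition R Q B S"
proof -
  define J :: "'k^2^2" where "J = vector [vector [0, -1], vector [1, 0]]"
  define R :: "'k^2^2" where "R = vector [vector [0, 0], vector [0, 1]]"
  define Q :: "'k^2^2" where "Q = mat 1"
  define B :: "'k^1^2" where "B = vector [vector [1], vector [0]]"
  define S :: "'k^1^1" where "S = 0"
  have J: "J $ 1 $ 1 = 0" "J $ 1 $ 2 = -1" "J $ 2 $ 1 = 1" "J $ 2 $ 2 = 0"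
    and R: "R $ 1 $ 1 = 0" "R $ 1 $ 2 = 0" "R $ 2 $ 1 = 0" "R $ 2 $ 2 = 1"
    and B: "B $ 1 $ 1 = 1" "B $ 2 $ 1 = 0"
    by (simp_all add: J_def R_def B_def)
  have sq: "conjugate a * a \<in> \<real>\<^sub>\<ge>\<^sub>0" for a :: 'k
    by (simp add: conjugate_mult_self nonneg_Reals_of_real_iff)
  have "J = - J\<^sup>H"
    by (simp add: vec_eq_iff forall_2 J ctranspose_def conjugate_one conjugate_neg)
  moreover have "R = R\<^sup>H"
    by (simp add: vec_eq_iff forall_2 R ctranspose_def conjugate_one)
  moreover have "psd R"
    by (simp add: psd_def qform_def matrix_vector_mult_def sum_2 R sq)
  moreover have "Q = Q\<^sup>H"
    by (simp add: vec_eq_iff forall_2 Q_def mat_def ctranspose_def conjugate_one)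
  moreover have "psd Q"
    by (simp add: psd_def qform_def Q_def sum_2 sq nonneg_Reals_add_I)
  moreover have "S = S\<^sup>H" "psd S"
    by (simp_all add: S_def vec_eq_iff ctranspose_def psd_def qform_def)
  moreover have "regular_pencil E_pencil (A_pencil J R Q B S)"
  proof (rule regular_optimality_pencil_if_trivial_kernel[where s = 0])
    fix l x :: "'k^2" and u :: "'k^1"
    assume 1: "0 *\<^sub>R x = ((J - R) ** Q) *v x + B *v u"
      and 2: "0 *\<^sub>R l + (((J - R) ** Q)\<^sup>H) *v l + (Q ** R ** Q) *v x = 0"
      and 3: "(B\<^sup>H) *v l + S *v u = 0"
    have "l $ 1 = 0"
      using 3 by (simp add: vec_eq_iff S_def matrix_vector_mult_def ctranspose_def sum_2 B conjugate_one)
    moreover have "l $ 2 = 0 \<and> - (l $ 1) - l $ 2 + x $ 2 = 0"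
      using 2 by (auto simp add: vec_eq_iff forall_2 Q_def matrix_vector_mult_def ctranspose_def sum_2 J R
          conjugate_one conjugate_neg)
    moreover have "- (x $ 2) + u $ 1 = 0 \<and> x $ 1 - x $ 2 = 0"
      using 1 by (simp add: vec_eq_iff forall_2 Q_def matrix_vector_mult_def sum_2 J R B)
    ultimately show "l = 0 \<and> x = 0 \<and> u = 0"
      by (auto simp: vec_eq_iff forall_2)
  qed
  moreover have "\<not> kernel_condition R Q B S"
  proof
    assume "kernel_condition R Q B S"
    moreover have "S *v 1 = 0" by (simp add: S_def)
    moreover have "R *v (Q *v (B *v 1)) = 0"
      by (simp add: vec_eq_iff forall_2 Q_def mat_def matrix_vector_mult_def sum_2 R B)
    ultimately have "(1 :: 'k^1) = 0" by (rule kernel_condition_inject)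
    then show False by simp
  qed
  ultimately show ?thesis unfolding Sigma_pH_def by blast
qed

section \<open>Uniqueness of optimal controls\<close>

text \<open>
  Differentiating \<open>C z = 0\<close> gives \<open>C (A z) + C (B w) = 0\<close>. Since \<open>w\<close> can be recovered linearly from
  \<open>C (B w)\<close> and \<open>S w\<close>, this is a state feedback, and the closed loop system has only the trivial
  solution with initial value zero.
\<close>

lemma zero_input_if_zero_outputs:
  fixes A :: "'x::euclidean_space \<Rightarrow> 'x" and B :: "'u::euclidean_space \<Rightarrow> 'x"
    and C :: "'x \<Rightarrow> 'y::euclidean_space" and S :: "'u \<Rightarrow> 'v::euclidean_space"
  assumes A: "linear A" and B: "linear B" and C: "linear C" and S: "linear S"
    and inj: "\<And>u. S u = 0 \<Longrightarrow> C (B u) = 0 \<Longrightarrow> u = 0"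
    and z: "abs_cont_on a b z" and z0: "z a = 0"
    and dz: "AE t in lebesgue. t \<in> {a..b} \<longrightarrow>
      (z has_vector_derivative A (z t) + B (w t)) (at t within {a..b})"
    and Cz: "AE t in lebesgue. t \<in> {a..b} \<longrightarrow> C (z t) = 0"
    and Sw: "AE t in lebesgue. t \<in> {a..b} \<longrightarrow> S (w t) = 0"
  shows "AE t in lebesgue. t \<in> {a..b} \<longrightarrow> w t = 0"
proof -
  have lin_\<Psi>: "linear (\<lambda>u. (C (B u), S u))"
    by (rule linearI) (simp_all add: linear_add[OF A] linear_add[OF B] linear_add[OF C] linear_add[OF S]
        linear_cmul[OF B] linear_cmul[OF C] linear_cmul[OF S])
  have "inj (\<lambda>u. (C (B u), S u))"
    unfolding linear_injective_0[OF lin_\<Psi>] using inj by (auto simp: zero_prod_def)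
  then obtain G where G: "linear G" and "G \<circ> (\<lambda>u. (C (B u), S u)) = id"
    using linear_injective_left_inverse[OF lin_\<Psi>] by blast
  then have GI: "G (C (B u), S u) = u" for u by (metis comp_apply id_apply)
  define K where "K x = G (- C (A x), 0)" for x
  have K: "linear K"
  proof (rule linearI)
    show "K (x + y) = K x + K y" for x y
      using linear_add[OF G, of "(- C (A x), 0)" "(- C (A y), 0)"]
      by (simp add: K_def linear_add[OF A] linear_add[OF C])
    show "K (r *\<^sub>R x) = r *\<^sub>R K x" for r x
      using linear_cmul[OF G, of r "(- C (A x), 0)"]
      by (simp add: K_def linear_cmul[OF A] linear_cmul[OF C])
  qed
  have Cz0: "C (z t) = 0" if t: "t \<in> {a<..<b}" for t
  proof -
    have "continuous_on {a..b} (\<lambda>t. C (z t))"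
      by (rule linear_continuous_on_compose[OF abs_cont_on_imp_continuous_on[OF z] C])
    then have "closed ({a..b} \<inter> (\<lambda>t. C (z t)) -` {0})"
      by (rule continuous_closed_preimage) auto
    moreover have "AE t\<in>{a<..<b} in lebesgue. t \<in> {a..b} \<inter> (\<lambda>t. C (z t)) -` {0}"
      using Cz by eventually_elim auto
    ultimately have "t \<in> {a..b} \<inter> (\<lambda>t. C (z t)) -` {0}"
      using mem_closed_if_AE_lebesgue_open[OF open_greaterThanLessThan] t by blast
    then show ?thesis by simp
  qed
  have ends: "AE t in lebesgue. t \<noteq> a" "AE t in lebesgue. t \<noteq> b"
    by (auto intro!: AE_I'[of "{_}"] negligible_iff_null_sets[THEN iffD1])
  have wK: "AE t in lebesgue. t \<in> {a..b} \<longrightarrow> w t = K (z t)"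
    using dz Sw ends
  proof eventually_elim
    case (elim t)
    show ?case
    proof
      assume "t \<in> {a..b}"
      then have t: "t \<in> {a<..<b}" and d: "(z has_vector_derivative A (z t) + B (w t)) (at t within {a..b})"
        using elim by auto
      have "(z has_vector_derivative A (z t) + B (w t)) (at t within {a<..<b})"
        by (rule has_vector_derivative_within_subset[OF d]) auto
      then have "(z has_vector_derivative A (z t) + B (w t)) (at t)"
        unfolding at_within_open[OF t open_greaterThanLessThan] .
      moreover have "bounded_linear C" using C by (simp add: linear_conv_bounded_linear)
      ultimately have "((\<lambda>t. C (z t)) has_vector_derivative C (A (z t) + B (w t))) (at t)"
        using bounded_linear.has_vector_derivative by blast
      moreover have "((\<lambda>t. C (z t)) has_vector_derivative 0) (at t)"
        by (rule has_vector_derivative_transform_within_open[of "\<lambda>_. 0" _ _ "{a<..<b}"])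
          (use t Cz0 in auto)
      ultimately have "C (A (z t) + B (w t)) = 0" by (rule vector_derivative_unique_at)
      then have "C (B (w t)) = - C (A (z t))"
        by (simp add: linear_add[OF C] eq_neg_iff_add_eq_0 add.commute)
      then show "w t = K (z t)"
        using GI[of "w t"] elim \<open>t \<in> {a..b}\<close> by (simp add: K_def)
    qed
  qed
  have lin: "linear (\<lambda>x. A x + B (K x))"
    using linear_compose_add[OF A linear_compose[OF K B]] by (simp add: comp_def)
  have dz': "AE t in lebesgue. t \<in> {a..b} \<longrightarrow>
      (z has_vector_derivative A (z t) + B (K (z t))) (at t within {a..b})"
    using dz wK by eventually_elim simp
  have z_zero: "z t = 0" if "t \<in> {a..b}" for t
    by (rule linear_ode_zero_unique[OF lin z z0 dz' that])
  show ?thesis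
    using wK by eventually_elim (use z_zero in \<open>simp add: linear_0[OF K]\<close>)
qed

definition running_cost ::
    "'k::real_or_complex^'n^'n \<Rightarrow> 'k^'n^'n \<Rightarrow> 'k^'m^'m \<Rightarrow> 'k^'n \<Rightarrow> 'k^'m \<Rightarrow> real"
  where "running_cost R Q S x u = ((Q ** R ** Q) *v x) \<bullet> x + (S *v u) \<bullet> u"

lemma cost_eq_running_cost:
  "cost R Q S t0 t1 x u
    = (1/2) * (\<integral>\<^sup>+t. ennreal (running_cost R Q S (x t) (u t)) \<partial>lebesgue_on {t0..t1})"
  unfolding cost_def running_cost_def
  by (subst nn_integral_restrict_space) (simp_all add: inner_add_left qform_inner_one)

lemma running_cost_parallelogram:
  "running_cost R Q S ((1/2) *\<^sub>R x + (1/2) *\<^sub>R y) ((1/2) *\<^sub>R u + (1/2) *\<^sub>R v)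
    + running_cost R Q S ((1/2) *\<^sub>R x + (-1/2) *\<^sub>R y) ((1/2) *\<^sub>R u + (-1/2) *\<^sub>R v)
    = (1/2) * (running_cost R Q S x u + running_cost R Q S y v)"
proof -
  have *: "(M *v ((1/2) *\<^sub>R x + (1/2) *\<^sub>R y)) \<bullet> ((1/2) *\<^sub>R x + (1/2) *\<^sub>R y)
      + (M *v ((1/2) *\<^sub>R x + (-1/2) *\<^sub>R y)) \<bullet> ((1/2) *\<^sub>R x + (-1/2) *\<^sub>R y)
      = (1/2) * ((M *v x) \<bullet> x + (M *v y) \<bullet> y)" for M :: "'k::real_or_complex^'l^'l" and x y
    unfolding linear_add[OF matrix_vector_mul_linear] linear_cmul[OF matrix_vector_mul_linear]
    by (simp add: inner_add_left inner_add_right inner_diff_left inner_diff_right field_simps)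
  have arith: "p + p' + (q + q') = (1/2) * (c + c' + (d + d'))"
    if "p + q = (1/2) * (c + d)" "p' + q' = (1/2) * (c' + d')" for p p' q q' c c' d d' :: real
    using that by (simp add: field_simps)
  show ?thesis
    unfolding running_cost_def by (rule arith[OF * *])
qed

lemma running_cost_nonneg:
  assumes "Q = Q\<^sup>H" "psd R" "psd S"
  shows "0 \<le> running_cost R Q S x u"
  using psd_inner_nonneg[OF assms(2)] psd_inner_nonneg[OF assms(3)]
  unfolding running_cost_def inner_QRQ[OF assms(1)] by (intro add_nonneg_nonneg)

lemma running_cost_eq_0D:
  assumes R: "R = R\<^sup>H" "psd R" and Q: "Q = Q\<^sup>H" and S: "S = S\<^sup>H" "psd S"
    and 0: "running_cost R Q S x u = 0"
  shows "R *v (Q *v x) = 0" "S *v u = 0"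
proof -
  have "(R *v (Q *v x)) \<bullet> (Q *v x) = 0" "(S *v u) \<bullet> u = 0"
    using psd_inner_nonneg[OF R(2), of "Q *v x"] psd_inner_nonneg[OF S(2), of u] 0
    unfolding running_cost_def inner_QRQ[OF Q] by linarith+
  then show "R *v (Q *v x) = 0" "S *v u = 0"
    using hermitian_psd_inner_eq_0_imp R S by blast+
qed

lemma continuous_on_matrix_vector_mult:
  fixes M :: "'k::real_or_complex^'c^'r" and f :: "'a::euclidean_space \<Rightarrow> 'k^'c"
  assumes "continuous_on T f"
  shows "continuous_on T (\<lambda>t. M *v f t)"
  using assms by (rule linear_continuous_on_compose[where g = "(*v) M"]) simp

lemma borel_measurable_matrix_vector_mult:
  fixes M :: "'k::real_or_complex^'c^'r"
  assumes "f \<in> borel_measurable N"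
  shows "(\<lambda>t. M *v f t) \<in> borel_measurable N"
  by (rule borel_measurable_continuous_on[OF _ assms])
    (intro continuous_on_matrix_vector_mult continuous_on_id)

lemma borel_measurable_running_cost:
  fixes R Q :: "'k::real_or_complex^'n^'n" and S :: "'k^'m^'m"
  assumes "x \<in> borel_measurable N" "u \<in> borel_measurable N"
  shows "(\<lambda>t. running_cost R Q S (x t) (u t)) \<in> borel_measurable N"
  unfolding running_cost_def using assms
  by (intro borel_measurable_add borel_measurable_inner borel_measurable_matrix_vector_mult)

lemma admissible_borel_measurable:
  assumes "admissible J R Q B t0 t1 x0 x1 x u"
  shows "x \<in> borel_measurable (lebesgue_on {t0..t1})" "u \<in> borel_measurable (lebesgue_on {t0..t1})"
proof -
  have "abs_cont_on t0 t1 x" "u absolutely_integrable_on {t0..t1}"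
    using assms unfolding admissible_def by blast+
  then show "x \<in> borel_measurable (lebesgue_on {t0..t1})" "u \<in> borel_measurable (lebesgue_on {t0..t1})"
    by (simp_all add: continuous_imp_measurable_on_sets_lebesgue abs_cont_on_imp_continuous_on
        absolutely_integrable_imp_borel_measurable)
qed

lemma admissible_lincomb:
  fixes J R Q :: "'k::real_or_complex^'n^'n" and B :: "'k^'m^'n"
  assumes xu: "admissible J R Q B t0 t1 x0 x1 x u" and yv: "admissible J R Q B t0 t1 y0 y1 y v"
  shows "admissible J R Q B t0 t1 (r *\<^sub>R x0 + s *\<^sub>R y0) (r *\<^sub>R x1 + s *\<^sub>R y1)
    (\<lambda>t. r *\<^sub>R x t + s *\<^sub>R y t) (\<lambda>t. r *\<^sub>R u t + s *\<^sub>R v t)"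
  unfolding admissible_def
proof (intro conjI)
  show "(\<lambda>t. r *\<^sub>R u t + s *\<^sub>R v t) absolutely_integrable_on {t0..t1}"
    using xu yv unfolding admissible_def
    by (intro set_integral_add absolutely_integrable_scaleR_left) auto
  show "abs_cont_on t0 t1 (\<lambda>t. r *\<^sub>R x t + s *\<^sub>R y t)"
    using xu yv unfolding admissible_def by (intro abs_cont_on_lincomb) auto
  have "AE t in lebesgue. t \<in> {t0..t1} \<longrightarrow>
       (x has_vector_derivative (((J - R) ** Q) *v x t + B *v u t)) (at t within {t0..t1})"
    "AE t in lebesgue. t \<in> {t0..t1} \<longrightarrow>
       (y has_vector_derivative (((J - R) ** Q) *v y t + B *v v t)) (at t within {t0..t1})"
    using xu yv unfolding admissible_def by blast+
  then show "AE t in lebesgue. t \<in> {t0..t1} \<longrightarrow> ((\<lambda>t. r *\<^sub>R x t + s *\<^sub>R y t) has_vector_derivative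
      (((J - R) ** Q) *v (r *\<^sub>R x t + s *\<^sub>R y t) + B *v (r *\<^sub>R u t + s *\<^sub>R v t))) (at t within {t0..t1})"
  proof eventually_elim
    case (elim t)
    show ?case
    proof
      assume "t \<in> {t0..t1}"
      with elim have d: "(x has_vector_derivative (((J - R) ** Q) *v x t + B *v u t)) (at t within {t0..t1})"
        "(y has_vector_derivative (((J - R) ** Q) *v y t + B *v v t)) (at t within {t0..t1})" by auto
      note sc = bounded_linear.has_vector_derivative[OF bounded_linear_scaleR_right]
      have "(r *\<^sub>R (((J - R) ** Q) *v x t + B *v u t) + s *\<^sub>R (((J - R) ** Q) *v y t + B *v v t))
          = ((J - R) ** Q) *v (r *\<^sub>R x t + s *\<^sub>R y t) + B *v (r *\<^sub>R u t + s *\<^sub>R v t)"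
        unfolding linear_add[OF matrix_vector_mul_linear] linear_cmul[OF matrix_vector_mul_linear]
        by (simp add: scaleR_add_right add_ac)
      with has_vector_derivative_add[OF sc[OF d(1), of r] sc[OF d(2), of s]]
      show "((\<lambda>t. r *\<^sub>R x t + s *\<^sub>R y t) has_vector_derivative
        (((J - R) ** Q) *v (r *\<^sub>R x t + s *\<^sub>R y t) + B *v (r *\<^sub>R u t + s *\<^sub>R v t))) (at t within {t0..t1})"
        by (simp only:)
    qed
  qed
qed (use xu yv in \<open>simp_all add: admissible_def\<close>)

text \<open>
  An integrable control can have infinite cost, and if all controls had, then all of them would be
  optimal. Replacing the control by a continuous one with the same endpoints excludes this.
\<close>

lemma admissible_imp_finite_cost:
  fixes J R Q :: "'k::real_or_complex^'n^'n" and B :: "'k^'m^'n" and S :: "'k^'m^'m"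
  assumes xu: "admissible J R Q B t0 t1 x0 x1 x u" and t: "t0 < t1"
  obtains x' u' where "admissible J R Q B t0 t1 x0 x1 x' u'" "cost R Q S t0 t1 x' u' < \<infinity>"
proof -
  let ?A = "(*v) ((J - R) ** Q)" and ?B = "(*v) B"
  have lA: "linear ?A" and lB: "linear ?B" by (rule matrix_vector_mul_linear)+
  have ac: "abs_cont_on t0 t1 x" and ends: "x t0 = x0" "x t1 = x1"
    and dx: "AE t in lebesgue. t \<in> {t0..t1} \<longrightarrow>
      (x has_vector_derivative ?A (x t) + ?B (u t)) (at t within {t0..t1})"
    using xu unfolding admissible_def by auto
  obtain y p where y: "y t0 = x t0" "y t1 = x t1"
    "\<And>t. (y has_vector_derivative ?A (y t) + ?B (adjoint ?B (p t))) (at t)"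
    and p: "\<And>t. (p has_vector_derivative - adjoint ?A (p t)) (at t)"
    using reachable_by_costate_control[OF lA lB less_imp_le[OF t] ac dx] by blast
  define v where "v t = adjoint ?B (p t)" for t
  have cy: "continuous_on {t0..t1} y" by (rule continuous_on_if_has_vector_derivative[OF y(3)])
  have cv: "continuous_on {t0..t1} v"
    unfolding v_def
    by (rule linear_continuous_on_compose[OF continuous_on_if_has_vector_derivative[OF p]
          adjoint_euclidean(1)[OF lB]])
  have "continuous_on {t0..t1} (\<lambda>t. ?A (y t) + ?B (adjoint ?B (p t)))"
    using cy cv unfolding v_def by (intro continuous_on_add continuous_on_matrix_vector_mult)
  then have "abs_cont_on t0 t1 y" by (rule abs_cont_on_if_continuous_derivative[OF y(3)])
  then have adm: "admissible J R Q B t0 t1 x0 x1 y v"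
    unfolding admissible_def using y ends has_vector_derivative_at_within[OF y(3)]
    by (auto simp: v_def[symmetric] intro!: absolutely_integrable_continuous_real cv)
  have "continuous_on {t0..t1} (\<lambda>t. running_cost R Q S (y t) (v t))"
    unfolding running_cost_def
    by (intro continuous_on_add continuous_on_inner continuous_on_matrix_vector_mult cy cv)
  then have "bounded ((\<lambda>t. running_cost R Q S (y t) (v t)) ` {t0..t1})"
    by (intro compact_imp_bounded compact_continuous_image compact_Icc)
  then obtain K where "\<forall>r\<in>(\<lambda>t. running_cost R Q S (y t) (v t)) ` {t0..t1}. norm r \<le> K"
    unfolding bounded_iff by blast
  then have K: "\<bar>running_cost R Q S (y t) (v t)\<bar> \<le> K" if "t \<in> {t0..t1}" for t
    using that by simp
  have "(\<integral>\<^sup>+t. ennreal (running_cost R Q S (y t) (v t)) \<partial>lebesgue_on {t0..t1})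
      \<le> (\<integral>\<^sup>+t. ennreal K \<partial>lebesgue_on {t0..t1})"
    by (rule nn_integral_mono) (use K in \<open>auto intro!: ennreal_leI dest: abs_le_D1\<close>)
  also have "\<dots> = ennreal K * emeasure lebesgue {t0..t1}"
    by (simp add: emeasure_restrict_space)
  also have "\<dots> < \<infinity>"
    using t by (simp add: ennreal_mult_less_top)
  finally have fin: "(\<integral>\<^sup>+t. ennreal (running_cost R Q S (y t) (v t)) \<partial>lebesgue_on {t0..t1}) < \<infinity>" .
  have "ennreal (1/2) = 1/2" using divide_ennreal[of 1 2] by simp
  then have "(1/2 :: ennreal) < \<infinity>" by (metis ennreal_less_top infinity_ennreal_def)
  with fin have "cost R Q S t0 t1 y v < \<infinity>"
    unfolding cost_eq_running_cost by (simp only: ennreal_mult_less_top infinity_ennreal_def simp_thms)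
  then show thesis using adm that by blast
qed

text \<open>
  By the parallelogram identity, the cost of half the difference of two optimal pairs is at most
  the difference between the optimal cost and the cost of their mean, hence zero.
\<close>

lemma optimal_difference_running_cost_zero:
  fixes J R Q :: "'k::real_or_complex^'n^'n" and B :: "'k^'m^'n" and S :: "'k^'m^'m"
  assumes Q: "Q = Q\<^sup>H" and psd: "psd R" "psd S" and t: "t0 < t1"
    and xu: "admissible J R Q B t0 t1 x0 x1 x u" and yv: "admissible J R Q B t0 t1 x0 x1 y v"
    and optx: "\<And>x' u'. admissible J R Q B t0 t1 x0 x1 x' u' \<Longrightarrow> cost R Q S t0 t1 x u \<le> cost R Q S t0 t1 x' u'"
    and opty: "\<And>x' u'. admissible J R Q B t0 t1 x0 x1 x' u' \<Longrightarrow> cost R Q S t0 t1 y v \<le> cost R Q S t0 t1 x' u'"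
  shows "AE t in lebesgue. t \<in> {t0..t1} \<longrightarrow>
    running_cost R Q S ((1/2) *\<^sub>R x t + (-1/2) *\<^sub>R y t) ((1/2) *\<^sub>R u t + (-1/2) *\<^sub>R v t) = 0"
proof -
  let ?L = "lebesgue_on {t0..t1}"
  define f where "f t = running_cost R Q S (x t) (u t)" for t
  define g where "g t = running_cost R Q S (y t) (v t)" for t
  define mid where "mid t = running_cost R Q S ((1/2) *\<^sub>R x t + (1/2) *\<^sub>R y t) ((1/2) *\<^sub>R u t + (1/2) *\<^sub>R v t)" for t
  define dif where "dif t = running_cost R Q S ((1/2) *\<^sub>R x t + (-1/2) *\<^sub>R y t) ((1/2) *\<^sub>R u t + (-1/2) *\<^sub>R v t)" for t
  define c where "c = cost R Q S t0 t1 x u"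
  have nn: "f t \<ge> 0" "g t \<ge> 0" "mid t \<ge> 0" "dif t \<ge> 0" for t
    unfolding f_def g_def mid_def dif_def by (rule running_cost_nonneg[OF Q psd])+
  note adm_mid = admissible_lincomb[OF xu yv, of "1/2" "1/2"]
  note adm_dif = admissible_lincomb[OF xu yv, of "1/2" "-1/2"]
  have meas: "f \<in> borel_measurable ?L" "g \<in> borel_measurable ?L" "mid \<in> borel_measurable ?L"
    "dif \<in> borel_measurable ?L"
    unfolding f_def[abs_def] g_def[abs_def] mid_def[abs_def] dif_def[abs_def]
    by (rule borel_measurable_running_cost admissible_borel_measurable[OF xu]
        admissible_borel_measurable[OF yv] admissible_borel_measurable[OF adm_mid]
        admissible_borel_measurable[OF adm_dif])+
  have cost_f: "c = (1/2) * (\<integral>\<^sup>+t. ennreal (f t) \<partial>?L)"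
    unfolding c_def f_def by (rule cost_eq_running_cost)
  have cost_g: "c = (1/2) * (\<integral>\<^sup>+t. ennreal (g t) \<partial>?L)"
    using optx[OF yv] opty[OF xu] unfolding c_def g_def cost_eq_running_cost[symmetric] by (rule antisym)
  have "admissible J R Q B t0 t1 x0 x1 (\<lambda>t. (1/2) *\<^sub>R x t + (1/2) *\<^sub>R y t) (\<lambda>t. (1/2) *\<^sub>R u t + (1/2) *\<^sub>R v t)"
    using adm_mid by (simp add: scaleR_add_left[symmetric])
  then have "c \<le> (1/2) * (\<integral>\<^sup>+t. ennreal (mid t) \<partial>?L)"
    unfolding c_def mid_def cost_eq_running_cost[symmetric] by (rule optx)
  then have cost_mid: "c + c \<le> (\<integral>\<^sup>+t. ennreal (mid t) \<partial>?L)"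
  proof -
    assume "c \<le> (1/2) * (\<integral>\<^sup>+t. ennreal (mid t) \<partial>?L)"
    then have "2 * c \<le> 2 * ((1/2) * (\<integral>\<^sup>+t. ennreal (mid t) \<partial>?L))" by (rule mult_left_mono) simp
    also have "\<dots> = (\<integral>\<^sup>+t. ennreal (mid t) \<partial>?L)"
      by (simp add: mult.assoc[symmetric] ennreal_times_divide)
    finally show ?thesis by (simp add: mult_2)
  qed
  have "(\<integral>\<^sup>+t. ennreal (mid t) \<partial>?L) + (\<integral>\<^sup>+t. ennreal (dif t) \<partial>?L)
      = (\<integral>\<^sup>+t. ennreal (mid t + dif t) \<partial>?L)"
    using meas nn by (subst nn_integral_add[symmetric]) (simp_all add: ennreal_plus)
  also have "\<dots> = (\<integral>\<^sup>+t. (1/2) * ennreal (f t) + (1/2) * ennreal (g t) \<partial>?L)"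
  proof (rule nn_integral_cong)
    fix t
    have "mid t + dif t = (1/2) * f t + (1/2) * g t"
      using running_cost_parallelogram[of R Q S "x t" "y t" "u t" "v t"]
      by (simp add: f_def g_def mid_def dif_def)
    also have "ennreal \<dots> = ennreal ((1/2) * f t) + ennreal ((1/2) * g t)"
      by (rule ennreal_plus) (use nn(1,2)[of t] in auto)
    also have "\<dots> = ennreal (1/2) * ennreal (f t) + ennreal (1/2) * ennreal (g t)"
      using nn(1,2)[of t] by (simp only: ennreal_mult[of "1/2"] divide_nonneg_nonneg zero_le_one zero_le_numeral)
    also have "ennreal (1/2) = 1/2" using divide_ennreal[of 1 2] by simp
    finally show "ennreal (mid t + dif t) = (1/2) * ennreal (f t) + (1/2) * ennreal (g t)" .
  qed
  also have "\<dots> = c + c"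
    using meas by (subst nn_integral_add) (simp_all add: nn_integral_cmult cost_f[symmetric] cost_g[symmetric])
  finally have sum: "(\<integral>\<^sup>+t. ennreal (mid t) \<partial>?L) + (\<integral>\<^sup>+t. ennreal (dif t) \<partial>?L) = c + c" .
  have "c < \<infinity>"
  proof -
    obtain x' u' where "admissible J R Q B t0 t1 x0 x1 x' u'" "cost R Q S t0 t1 x' u' < \<infinity>"
      using admissible_imp_finite_cost[OF xu t] by blast
    then show ?thesis using optx unfolding c_def by (meson le_less_trans)
  qed
  then have fin: "c + c \<noteq> \<infinity>" by auto
  have "(c + c) + (\<integral>\<^sup>+t. ennreal (dif t) \<partial>?L) \<le> (c + c) + 0"
    using add_right_mono[OF cost_mid, of "\<integral>\<^sup>+t. ennreal (dif t) \<partial>?L"] unfolding sum by simp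
  then have "(\<integral>\<^sup>+t. ennreal (dif t) \<partial>?L) = 0"
    using fin unfolding ennreal_add_left_cancel_le by simp
  then have "AE t in ?L. ennreal (dif t) = 0"
    using meas(4) by (subst (asm) nn_integral_0_iff_AE) simp_all
  then have "AE t in lebesgue. t \<in> {t0..t1} \<longrightarrow> ennreal (dif t) = 0"
    by (subst (asm) AE_restrict_space_iff) simp_all
  then have "AE t in lebesgue. t \<in> {t0..t1} \<longrightarrow> dif t = 0"
    by eventually_elim (use nn(4) in \<open>auto simp: ennreal_eq_0_iff intro: antisym\<close>)
  then show ?thesis unfolding dif_def .
qed

lemma optimal_control_unique:
  fixes J R Q :: "'k::real_or_complex^'n^'n" and B :: "'k^'m^'n" and S :: "'k^'m^'m"
  assumes R: "R = R\<^sup>H" "psd R" and Q: "Q = Q\<^sup>H" and S: "S = S\<^sup>H" "psd S"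
    and ker: "kernel_condition R Q B S" and t: "t0 < t1"
    and u: "optimal_control J R Q B S t0 t1 x0 x1 u"
    and v: "optimal_control J R Q B S t0 t1 x0 x1 v"
  shows "AE t in lebesgue. t \<in> {t0..t1} \<longrightarrow> u t = v t"
proof -
  obtain x where xu: "admissible J R Q B t0 t1 x0 x1 x u" and
    optx: "\<And>x' u'. admissible J R Q B t0 t1 x0 x1 x' u' \<Longrightarrow> cost R Q S t0 t1 x u \<le> cost R Q S t0 t1 x' u'"
    using u unfolding optimal_control_def by blast
  obtain y where yv: "admissible J R Q B t0 t1 x0 x1 y v" and
    opty: "\<And>x' u'. admissible J R Q B t0 t1 x0 x1 x' u' \<Longrightarrow> cost R Q S t0 t1 y v \<le> cost R Q S t0 t1 x' u'"
    using v unfolding optimal_control_def by blast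
  define z where "z t = (1/2) *\<^sub>R x t + (-1/2) *\<^sub>R y t" for t
  define w where "w t = (1/2) *\<^sub>R u t + (-1/2) *\<^sub>R v t" for t
  have "AE t in lebesgue. t \<in> {t0..t1} \<longrightarrow> running_cost R Q S (z t) (w t) = 0"
    unfolding z_def w_def
    by (rule optimal_difference_running_cost_zero[OF Q R(2) S(2) t xu yv optx opty])
  then have RQz: "AE t in lebesgue. t \<in> {t0..t1} \<longrightarrow> R *v (Q *v z t) = 0"
    and Sw: "AE t in lebesgue. t \<in> {t0..t1} \<longrightarrow> S *v w t = 0"
    by (eventually_elim, use running_cost_eq_0D[OF R Q S] in blast)+
  have adm: "admissible J R Q B t0 t1 ((1/2) *\<^sub>R x0 + (-1/2) *\<^sub>R x0) ((1/2) *\<^sub>R x1 + (-1/2) *\<^sub>R x1) z w"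
    unfolding z_def[abs_def] w_def[abs_def] by (rule admissible_lincomb[OF xu yv])
  have z: "abs_cont_on t0 t1 z" and z0: "z t0 = 0" and dz: "AE t in lebesgue. t \<in> {t0..t1} \<longrightarrow>
       (z has_vector_derivative (((J - R) ** Q) *v z t + B *v w t)) (at t within {t0..t1})"
    using adm unfolding admissible_def by (auto simp: scaleR_add_left[symmetric])
  have linRQ: "linear (\<lambda>x. R *v (Q *v x))"
    using linear_compose[OF matrix_vector_mul_linear[of Q] matrix_vector_mul_linear[of R]]
    by (simp add: comp_def)
  have "AE t in lebesgue. t \<in> {t0..t1} \<longrightarrow> w t = 0"
    by (rule zero_input_if_zero_outputs[OF matrix_vector_mul_linear matrix_vector_mul_linear linRQ
          matrix_vector_mul_linear kernel_condition_inject[OF ker] z z0 dz RQz Sw])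
  then show ?thesis
    by eventually_elim (auto simp: w_def scaleR_diff_right[symmetric])
qed

theorem proposition3p8:
  fixes J R Q :: "'k::real_or_complex^'n^'n" and B :: "'k^'m^'n" and S :: "'k^'m^'m"
  assumes "(J, R, Q, B) \<in> Sigma_pH" and "S = S\<^sup>H" and "psd S"
  shows "(kernel_condition R Q B S \<longrightarrow> regular_pencil E_pencil (A_pencil J R Q B S)) \<and>
    (\<exists>(J' :: 'k^2^2) (R' :: 'k^2^2) (Q' :: 'k^2^2) (B' :: 'k^1^2) (S' :: 'k^1^1).
       (J', R', Q', B') \<in> Sigma_pH \<and> S' = S'\<^sup>H \<and> psd S' \<and>
       regular_pencil E_pencil (A_pencil J' R' Q' B' S') \<and> \<not> kernel_condition R' Q' B' S') \<and>
    (kernel_condition R Q B S \<longrightarrow>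
       (\<forall>(t0::real) (t1::real) (x0 :: 'k^'n) (x1 :: 'k^'n) u v. t0 < t1 \<longrightarrow>
          optimal_control J R Q B S t0 t1 x0 x1 u \<longrightarrow>
          optimal_control J R Q B S t0 t1 x0 x1 v \<longrightarrow>
          (AE t in lebesgue. t \<in> {t0..t1} \<longrightarrow> u t = v t)))"
proof -
  have RQ: "R = R\<^sup>H" "psd R" "Q = Q\<^sup>H"
    using assms(1) by (simp_all add: Sigma_pH_def)
  show ?thesis
    using kernel_condition_imp_regular[OF RQ assms(2)] regular_without_kernel_condition
      optimal_control_unique[OF RQ assms(2,3)] by blast
qed

end
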